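(* For every $n\ge 1$, $$\sum_{\sigma \in NC_n} q^{\operatorname{maj}(\sigma) + \operatorname{imaj}(\sigma)} \;=\; \sum_{\sigma \in \operatorname{Sort}_n} q^{\operatorname{maj}(\sigma) + \operatorname{imaj}(\sigma)} \;=\; \frac{1}{[n+1]_q}\begin{bmatrix} 2n \\ n \end{bmatrix}_q .$$
   Context: $\mathcal{S}_n$ is the set of permutations of $\{1,\dots,n\}$, written in one-line notation $\sigma=[\sigma_1,\dots,\sigma_n]$. A set partition of a totally ordered finite set is noncrossing if there are no elements $a<b<c<d$ with $a,c$ in one block and $b,d$ in another block. $NC_n\subseteq\mathcal{S}_n$ is the set of permutations obtained from noncrossing set partitions $P$ of $\{1,\dots,n\}$ by sending $P$ to the permutation whose cycles are the blocks of $P$ written in increasing order (the block $\{i_1<\dots<i_k\}$ becomes the cycle $(i_1,\dots,i_k)$, i.e. $i_1\mapsto i_2\mapsto\dots\mapsto i_k\mapsto i_1$). $\operatorname{Sort}_n\subseteq\mathcal{S}_n$ is the set of $231$-avoiding permutations: those $\sigma$ for which there are no $a<b<c$ with $\sigma_c<\sigma_a<\sigma_b$. $\operatorname{Des}(\sigma)=\{1\le i<n:\sigma_i>\sigma_{i+1}\}$, $\operatorname{maj}(\sigma)=\sum_{i\in\operatorname{Des}(\sigma)}i$, $\operatorname{imaj}(\sigma)=\operatorname{maj}(\sigma^{-1})$. $[k]_q=1+q+\dots+q^{k-1}$, $[k]_q!=[1]_q[2]_q\cdots[k]_q$, and $\begin{bmatrix} k\\ l\end{bmatrix}_q=\dfrac{[k]_q!}{[l]_q!\,[k-l]_q!}$.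 *)

theory Defs
  imports
    "HOL-Library.Disjoint_Sets"
    "HOL-Combinatorics.Combinatorics"
    "HOL-Computational_Algebra.Computational_Algebra"
begin

text \<open>Permutations of \<open>{1..n}\<close> are functions \<open>\<sigma>\<close> with \<open>\<sigma> permutes {1..n}\<close>; the \<open>i\<close>-th entry of the
  one-line notation is \<open>\<sigma> i\<close>.\<close>

definition noncrossing :: "'a::linorder set set \<Rightarrow> bool" where
  "noncrossing P \<longleftrightarrow>
     \<not> (\<exists>B\<in>P. \<exists>C\<in>P. B \<noteq> C \<and>
          (\<exists>a b c d. a < b \<and> b < c \<and> c < d \<and> a \<in> B \<and> c \<in> B \<and> b \<in> C \<and> d \<in> C))"

text \<open>\<open>cycle_of_list [i\<^sub>1, ..., i\<^sub>k]\<close> is the cycle sending \<open>i\<^sub>1\<close> to \<open>i\<^sub>2\<close>, ..., \<open>i\<^sub>k\<close> to \<open>i\<^sub>1\<close>.\<close>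

definition NC :: "nat \<Rightarrow> (nat \<Rightarrow> nat) set" where
  "NC n = {\<sigma>. \<sigma> permutes {1..n} \<and>
     (\<exists>P. partition_on {1..n} P \<and> noncrossing P \<and>
        (\<forall>B\<in>P. \<forall>i\<in>B. \<sigma> i = cycle_of_list (sorted_list_of_set B) i))}"

definition Sort :: "nat \<Rightarrow> (nat \<Rightarrow> nat) set" where
  "Sort n = {\<sigma>. \<sigma> permutes {1..n} \<and>
     \<not> (\<exists>a b c. 1 \<le> a \<and> a < b \<and> b < c \<and> c \<le> n \<and> \<sigma> c < \<sigma> a \<and> \<sigma> a < \<sigma> b)}"

definition Des :: "nat \<Rightarrow> (nat \<Rightarrow> nat) \<Rightarrow> nat set" where
  "Des n \<sigma> = {i. 1 \<le> i \<and> i < n \<and> \<sigma> i > \<sigma> (i + 1)}"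

definition maj :: "nat \<Rightarrow> (nat \<Rightarrow> nat) \<Rightarrow> nat" where
  "maj n \<sigma> = (\<Sum>i\<in>Des n \<sigma>. i)"

definition imaj :: "nat \<Rightarrow> (nat \<Rightarrow> nat) \<Rightarrow> nat" where
  "imaj n \<sigma> = maj n (inv \<sigma>)"

definition qint :: "'a::semiring_1 \<Rightarrow> nat \<Rightarrow> 'a" where
  "qint q k = (\<Sum>i<k. q ^ i)"

definition qfact :: "'a::comm_semiring_1 \<Rightarrow> nat \<Rightarrow> 'a" where
  "qfact q k = (\<Prod>i=1..k. qint q i)"

definition qbinomial :: "'a::field \<Rightarrow> nat \<Rightarrow> nat \<Rightarrow> 'a" where
  "qbinomial q k l = qfact q k / (qfact q l * qfact q (k - l))"

text \<open>The indeterminate, as an element of the fraction field of \<open>\<int>[q]\<close>. There all \<open>q\<close>-integers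
  \<open>qint qvar k\<close> with \<open>k > 0\<close> are nonzero, so the quotients are genuine.\<close>

definition qvar :: "int poly fract" where
  "qvar = to_fract [:0, 1:]"

end

theory Submission
  imports Defs
begin

text \<open>
  Write \<open>n = m + 1\<close>. Both sums are transported to the same set of Dyck paths in disguise: the pairs
  \<open>(I, J)\<close> of subsets of \<open>{1..m}\<close> of equal size such that every \<open>{1..i}\<close> contains at least as many
  elements of \<open>I\<close> as of \<open>J\<close> (\<open>ballot m 0\<close>).

  A 231-avoiding \<open>\<sigma>\<close> goes to its descent set and the descent set of its inverse. Here maj + imaj
  is the sum of all elements of \<open>I\<close> and \<open>J\<close>. The map is injective because 231-avoidance forces the
  entries one by one from the right, once it is known which positions are descents and which values
  stand at them (\<open>descents_inj\<close>).

  A noncrossing \<open>\<sigma>\<close> goes to the set of \<open>i\<close> for which \<open>i + 1\<close> is the least element of its block and the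
  set of \<open>i < n\<close> that are the greatest element of their block (\<open>extremes\<close>). Blocks are opened and
  closed like brackets, so these data determine \<open>\<sigma>\<close>. Whether \<open>i\<close> is a descent of \<open>\<sigma>\<close> or of its
  inverse only depends on which of \<open>i\<close>, \<open>i + 1\<close> open or close a block (\<open>nested_descent_iff\<close>,
  \<open>nested_inv_descent_iff\<close>), and therefore maj + imaj becomes a weight on ballot pairs as well,
  this time a nonlinear one (\<open>close_wt\<close>).

  Both maps are onto. A ballot pair, read as a path, defines the noncrossing partition in which two
  points are together when they have the same height and the path does not dip below it in between;
  this inverts the second map. Writing down the blocks of that partition in the order of their least
  elements, each block decreasingly, gives a 231-avoiding permutation from which the partition can
  be recovered. So there are at least as many such permutations as ballot pairs, and the
  injective first map is bijective.

  Finally, each weight is summed over ballot pairs by adding the positions \<open>1, 2, ...\<close> one after the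
  other and keeping track of the excess \<open>h\<close> of \<open>I\<close> over \<open>J\<close>. This gives linear recurrences in \<open>m\<close>,
  solved by closed forms of reflection type: a Gaussian binomial coefficient at \<open>h\<close> minus one at
  \<open>h + 1\<close>, each times a power of \<open>q\<close>. At \<open>h = 0\<close> both closed
  forms are the \<open>q\<close>-Catalan number.
\<close>

section \<open>q-integers and inverse q-factorials\<close>

text \<open>The bracket \<open>[k]\<^sub>q\<close> for all integers \<open>k\<close>, so that shifted indices such as \<open>m - h\<close> may become
  zero or negative without case distinctions.\<close>

definition qbr :: "'a::field \<Rightarrow> int \<Rightarrow> 'a" where
  "qbr q k = (1 - q powi k) / (1 - q)"

text \<open>Like \<open>1/\<Gamma>\<close>, the reciprocal of the factorial vanishes at the negative integers. In this way
  \<open>qinvfact_diff_1\<close> holds for every integer, and the recurrences below need no boundary cases.\<close>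

definition qinvfact :: "'a::field \<Rightarrow> int \<Rightarrow> 'a" where
  "qinvfact q k = (if k < 0 then 0 else inverse (qfact q (nat k)))"

text \<open>Neither zero nor a root of unity; then no \<open>q\<close>-integer of positive index vanishes.\<close>

definition qgeneric :: "'a::field \<Rightarrow> bool" where
  "qgeneric q \<longleftrightarrow> q \<noteq> 0 \<and> (\<forall>k>0. q ^ k \<noteq> 1)"

lemma qint_conv_qbr:
  assumes "qgeneric q"
  shows "qint q k = qbr q (int k)"
proof -
  have "q \<noteq> 1" using assms unfolding qgeneric_def by (metis power_one_right zero_less_one)
  then show ?thesis
    unfolding qint_def qbr_def by (simp add: sum_gp_strict)
qed

lemma qbr_nonzero:
  assumes "qgeneric q" "k > 0"
  shows "qbr q k \<noteq> 0"
proof -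
  have "q \<noteq> 1" using assms unfolding qgeneric_def by (metis power_one_right zero_less_one)
  moreover obtain j where "k = int j" "j > 0" using assms(2) by (metis zero_less_imp_eq_int)
  ultimately show ?thesis using assms unfolding qbr_def qgeneric_def by simp
qed

lemma qfact_Suc: "qfact q (Suc k) = qfact q k * qint q (Suc k)"
  unfolding qfact_def by (simp add: prod.nat_ivl_Suc' mult.commute)

lemma qfact_nonzero:
  assumes "qgeneric q"
  shows "qfact q k \<noteq> 0"
  using assms unfolding qfact_def
  by (simp add: qint_conv_qbr qbr_nonzero)

lemma qinvfact_diff_1:
  assumes "qgeneric q"
  shows "qinvfact q (k - 1) = qbr q k * qinvfact q k"
proof (cases "k > 0")
  case True
  then obtain j where j: "k = int (Suc j)"
    by (metis Suc_pred' zero_less_imp_eq_int)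
  have "qbr q k \<noteq> 0" using qbr_nonzero assms True by blast
  then show ?thesis
    using qint_conv_qbr[OF assms, of "Suc j"] unfolding qinvfact_def j
    by (simp add: qfact_Suc nat_add_distrib)
next
  case False
  then show ?thesis unfolding qinvfact_def qbr_def by (cases "k = 0") auto
qed

lemma qinvfact_diff_2:
  assumes "qgeneric q"
  shows "qinvfact q (k - 2) = qbr q (k - 1) * (qbr q k * qinvfact q k)"
  using qinvfact_diff_1[OF assms, of k] qinvfact_diff_1[OF assms, of "k - 1"] by simp

section \<open>Closed forms for the weighted sums over ballot pairs\<close>

text \<open>In terms of Gaussian binomials this is
  \<open>q\<^bsup>h(h+1)/2\<^esup> ([2m+1, m-h] - q\<^bsup>h+1\<^esup> [2m+1, m-h-1])\<close>, combined into one product. It is what the reflection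
  principle gives: before the ballot condition, a pair with excess \<open>h\<close> is counted by the coefficient of
  \<open>z\<^sup>h\<close> in \<open>\<Prod>i=1..m. (1 + z q\<^sup>i) (1 + q\<^sup>i / z)\<close>, and the factor \<open>1 - 1/z\<^sup>2\<close> kills the coefficient of
  \<open>1/z\<close>; the finite Jacobi triple product does the rest.\<close>

definition linear_gf :: "'a::field \<Rightarrow> nat \<Rightarrow> int \<Rightarrow> 'a" where
  "linear_gf q m h = q powi (h * (h + 1) div 2) * qbr q (h + 1) * (1 + q ^ (m + 1))
     * qfact q (2 * m + 1) * qinvfact q (int m - h) * qinvfact q (int m + h + 2)"

text \<open>All terms are multiples of the reciprocal factorials at the largest indices that occur, \<open>X\<close> and \<open>Y\<close>.
  What remains is a polynomial identity between powers of \<open>q\<close>.\<close>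

lemma linear_gf_rec:
  assumes q: "qgeneric q"
  shows "linear_gf q (Suc m) h = (1 + q ^ (2 * m + 2)) * linear_gf q m h
            + q ^ (m + 1) * (linear_gf q m (h - 1) + linear_gf q m (h + 1))"
proof -
  define a where "a = q ^ m"
  \<comment> \<open>The exponents at \<open>h - 1\<close>, the smallest index that occurs, keep everything polynomial.\<close>
  define b where "b = q powi (h - 1)"
  define z where "z = q powi ((h - 1) * h div 2)"
  define c where "c = 1 / (1 - q)"
  define X where "X = qinvfact q (int m + 1 - h)"
  define Y where "Y = qinvfact q (int m + h + 3)"
  define F where "F = qfact q (2 * m + 1)"
  have q0: "q \<noteq> 0" using q unfolding qgeneric_def by simp
  have pa: "q powi (int m) = a" by (simp add: a_def)
  have pb: "q powi h = q * b" unfolding b_def using q0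
    by (metis add.commute diff_add_cancel power_int_add power_int_1_right)
  have e1: "h * (h + 1) div 2 = (h - 1) * h div 2 + h"
  proof -
    have "h * (h + 1) = (h - 1) * h + h * 2" by (simp add: algebra_simps)
    then show ?thesis by (metis div_mult_self1 add.commute zero_neq_numeral)
  qed
  have e2: "(h + 1) * (h + 1 + 1) div 2 = (h - 1) * h div 2 + h + (h + 1)"
  proof -
    have "(h + 1) * (h + 1 + 1) = (h - 1) * h + (h + (h + 1)) * 2" by (simp add: algebra_simps)
    then show ?thesis by (metis div_mult_self1 add.commute add.assoc zero_neq_numeral)
  qed
  have z1: "q powi (h * (h + 1) div 2) = z * (q * b)"
    unfolding e1 using q0 pb by (simp add: power_int_add z_def)
  have z2: "q powi ((h + 1) * (h + 1 + 1) div 2) = z * (q * b) * (q * q * b)"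
    unfolding e2 using q0 pb by (simp only: power_int_add simp_thms z_def power_int_1_right mult_ac)
  have z0: "q powi ((h - 1) * (h - 1 + 1) div 2) = z" by (simp add: z_def)
  have br: "qbr q k = c * (1 - q powi k)" for k by (simp add: qbr_def c_def)
  have F2: "qfact q (2 * Suc m + 1) = F * (c * (1 - a * a * q * q)) * (c * (1 - a * a * q * q * q))"
    using qint_conv_qbr[OF q] q0
    by (simp add: F_def qfact_Suc br a_def power_add mult_ac power2_eq_square[symmetric] power_int_add
        power_mult[symmetric])
  have bq: "qbr q h = c * (1 - q * b)" "qbr q (h + 1) = c * (1 - q * q * b)"
    "qbr q (h + 1 + 1) = c * (1 - q * q * q * b)"
    using q0 pb by (simp_all add: br power_int_add mult_ac power2_eq_square)
  have X1: "qinvfact q (int m - h) = qbr q (int m + 1 - h) * X"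
    unfolding X_def using qinvfact_diff_1[OF q, of "int m + 1 - h"] by (simp add: algebra_simps)
  have X2: "qinvfact q (int m - (h + 1)) = qbr q (int m - h) * (qbr q (int m + 1 - h) * X)"
    unfolding X_def using qinvfact_diff_2[OF q, of "int m + 1 - h"] by (simp add: algebra_simps)
  have Y1: "qinvfact q (int m + h + 2) = qbr q (int m + h + 3) * Y"
    unfolding Y_def using qinvfact_diff_1[OF q, of "int m + h + 3"] by (simp add: algebra_simps)
  have Y2: "qinvfact q (int m + (h - 1) + 2) = qbr q (int m + h + 2) * (qbr q (int m + h + 3) * Y)"
    unfolding Y_def using qinvfact_diff_2[OF q, of "int m + h + 3"] by (simp add: algebra_simps)
  have idx: "int m + (h + 1) + 2 = int m + h + 3"
    "int (Suc m) - h = int m + 1 - h" "int (Suc m) + h + 2 = int m + h + 3" by simp_all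
  have b0: "b \<noteq> 0" using q0 by (simp add: b_def)
  \<comment> \<open>\<open>d = q\<^bsup>m-h\<^esup>\<close>\<close>
  define d where "d = a / (q * b)"
  have ad: "a = d * q * b" using b0 q0 by (simp add: d_def)
  have bm: "qbr q (int m - h) = c * (1 - d)" "qbr q (int m + 1 - h) = c * (1 - q * d)"
    using q0 pb pa by (simp_all add: br power_int_add power_int_diff d_def mult_ac)
  have bp: "qbr q (int m + h + 2) = c * (1 - a * b * q * q * q)"
    "qbr q (int m + h + 3) = c * (1 - a * b * q * q * q * q)"
    using q0 pb pa by (simp_all add: br power_int_add mult_ac power2_eq_square power3_eq_cube)
  have "linear_gf q (Suc m) h = z * (q * b) * (c * (1 - q * q * b)) * (1 + a * q * q) *
       (F * (c * (1 - a * a * q * q)) * (c * (1 - a * a * q * q * q))) * X * Y"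
    unfolding linear_gf_def F2 z1 bq idx by (simp add: X_def[symmetric] Y_def[symmetric] a_def mult_ac)
  also have "\<dots> = (1 + a * a * q * q) * (z * (q * b) * (c * (1 - q * q * b)) * (1 + a * q) * F
         * (c * (1 - q * d) * X) * (c * (1 - a * b * q * q * q * q) * Y))
       + a * q * (z * (c * (1 - q * b)) * (1 + a * q) * F * X
            * (c * (1 - a * b * q * q * q) * (c * (1 - a * b * q * q * q * q) * Y))
          + z * (q * b) * (q * q * b) * (c * (1 - q * q * q * b)) * (1 + a * q) * F
             * (c * (1 - d) * (c * (1 - q * d) * X)) * Y)"
    unfolding ad by algebra
  also have "\<dots> = (1 + q ^ (2 * m + 2)) * linear_gf q m h
            + q ^ (m + 1) * (linear_gf q m (h - 1) + linear_gf q m (h + 1))"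
  proof -
    have w0: "linear_gf q m h = z * (q * b) * (c * (1 - q * q * b)) * (1 + a * q) * F
         * (c * (1 - q * d) * X) * (c * (1 - a * b * q * q * q * q) * Y)"
      unfolding linear_gf_def z1 bq X1 Y1 bm bp by (simp add: F_def a_def mult_ac)
    have w1: "linear_gf q m (h - 1) = z * (c * (1 - q * b)) * (1 + a * q) * F * X
            * (c * (1 - a * b * q * q * q) * (c * (1 - a * b * q * q * q * q) * Y))"
      unfolding linear_gf_def z0 Y2 bp using bq(1)
      by (simp add: F_def a_def X_def mult_ac diff_diff_eq2)
    have w2: "linear_gf q m (h + 1) = z * (q * b) * (q * q * b) * (c * (1 - q * q * q * b)) * (1 + a * q) * F
             * (c * (1 - d) * (c * (1 - q * d) * X)) * Y"
      unfolding linear_gf_def z2 X2 bm idx bq by (simp add: F_def a_def Y_def[symmetric] mult_ac)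
    have "q ^ (2 * m + 2) = a * a * q * q" "q ^ (m + 1) = a * q"
      by (simp_all add: a_def power_add power_mult power2_eq_square mult_ac power_mult_distrib mult_2)
    then show ?thesis unfolding w0 w1 w2 by (simp only:)
  qed
  finally show ?thesis .
qed


text \<open>The closed forms for the second weight, in the variants that belong to the two possible choices of
  the next bit. With \<open>c h = [2m+1, m-h]\<close> they are \<open>q\<^bsup>h(h+1)\<^esup> (c h - q\<^bsup>2h+1\<^esup> c (h+1))\<close> and
  \<open>q\<^bsup>(h+1)(h+1)\<^esup> (c h - q\<^bsup>2h+2\<^esup> c (h+1))\<close>: the reflection formulas for the major index of ballot
  sequences, with \<open>q\<close> replaced by \<open>1/q\<close> and multiplied by a power of \<open>q\<close>.\<close>

definition close_gf :: "'a::field \<Rightarrow> nat \<Rightarrow> int \<Rightarrow> 'a" where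
  "close_gf q m h = q powi (h * (h + 1)) * qfact q (2 * m + 1) *
     (qinvfact q (int m - h) * qinvfact q (int m + h + 1)
       - q powi (2 * h + 1) * qinvfact q (int m - h - 1) * qinvfact q (int m + h + 2))"

definition open_gf :: "'a::field \<Rightarrow> nat \<Rightarrow> int \<Rightarrow> 'a" where
  "open_gf q m h = q powi ((h + 1) * (h + 1)) * qfact q (2 * m + 1) *
     (qinvfact q (int m - h) * qinvfact q (int m + h + 1)
       - q powi (2 * h + 2) * qinvfact q (int m - h - 1) * qinvfact q (int m + h + 2))"

lemma close_open_gf_rec:
  assumes q: "qgeneric q"
  shows "close_gf q (Suc m) h = q ^ (m + 1) * open_gf q m (h - 1) + close_gf q m h
            + q ^ (m + 1) * open_gf q m h + q ^ (2 * m + 2) * close_gf q m (h + 1)"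
    and "open_gf q (Suc m) h = q ^ (2 * m + 3) * open_gf q m (h - 1) + q ^ (m + 2) * close_gf q m h
            + open_gf q m h + q ^ (m + 1) * close_gf q m (h + 1)"
proof -
  define b where "b = q powi h"
  \<comment> \<open>\<open>m - h - 1\<close> is the smallest index of a bracket involving \<open>m - h\<close>; all others are shifts of it.\<close>
  define e where "e = q powi (int m - h - 1)"
  define z where "z = q powi (h * h)"
  define c where "c = 1 / (1 - q)"
  define X where "X = qinvfact q (int m + 1 - h)"
  define Y where "Y = qinvfact q (int m + h + 3)"
  define F where "F = qfact q (2 * m + 1)"
  have q0: "q \<noteq> 0" using q unfolding qgeneric_def by simp
  have pa: "q ^ m = q * e * b"
  proof -
    have "q powi (int m) = q powi ((1 + (int m - h - 1)) + h)" by simp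
    also have "\<dots> = q * e * b" unfolding b_def e_def using q0
      by (simp only: power_int_add simp_thms power_int_1_right)
    finally show ?thesis by simp
  qed
  have pow: "q ^ (m + 1) = q * e * b * q" "q ^ (m + 2) = q * e * b * q * q"
    "q ^ (2 * m + 2) = (q * e * b * q) * (q * e * b * q)"
    "q ^ (2 * m + 3) = (q * e * b * q) * (q * e * b * q) * q"
    unfolding pa[symmetric]
    by (simp_all add: power_add power_mult power_mult_distrib power2_eq_square power3_eq_cube mult_ac mult_2)
  have pz: "q powi (h * (h + 1)) = z * b" "q powi ((h + 1) * (h + 1)) = z * b * b * q"
    "q powi ((h - 1 + 1) * (h - 1 + 1)) = z" "q powi ((h + 1) * (h + 1 + 1)) = z * b * b * b * q * q"
    "q powi (2 * h + 1) = b * b * q" "q powi (2 * h + 2) = b * b * q * q"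
    "q powi (2 * (h - 1) + 2) = b * b" "q powi (2 * (h + 1) + 1) = b * b * q * q * q"
  proof -
    have eqs: "h * (h + 1) = h * h + h" "(h + 1) * (h + 1) = h * h + h + h + 1"
      "(h - 1 + 1) * (h - 1 + 1) = h * h" "(h + 1) * (h + 1 + 1) = h * h + h + h + h + 1 + 1"
      "2 * h + 1 = h + h + 1" "2 * h + 2 = h + h + 1 + 1"
      "2 * (h - 1) + 2 = h + h" "2 * (h + 1) + 1 = h + h + 1 + 1 + 1"
      by (simp_all add: algebra_simps)
    show "q powi (h * (h + 1)) = z * b" "q powi ((h + 1) * (h + 1)) = z * b * b * q"
      "q powi ((h - 1 + 1) * (h - 1 + 1)) = z" "q powi ((h + 1) * (h + 1 + 1)) = z * b * b * b * q * q"
      "q powi (2 * h + 1) = b * b * q" "q powi (2 * h + 2) = b * b * q * q"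
      "q powi (2 * (h - 1) + 2) = b * b" "q powi (2 * (h + 1) + 1) = b * b * q * q * q"
      unfolding eqs z_def b_def using q0
      by (simp_all only: power_int_add simp_thms power_int_1_right)
  qed
  have br: "qbr q k = c * (1 - q powi k)" for k by (simp add: qbr_def c_def)
  have F2: "qfact q (2 * Suc m + 1) = F * (c * (1 - q * e * b * q * (q * e * b * q)))
       * (c * (1 - q * e * b * q * (q * e * b * q) * q))"
  proof -
    have "qfact q (2 * Suc m + 1) = F * qbr q (int (2 * m + 2)) * qbr q (int (2 * m + 3))"
      unfolding F_def by (simp add: qfact_Suc qint_conv_qbr[OF q] numeral_eq_Suc)
    then show ?thesis unfolding br power_int_of_nat pow .
  qed
  have u: "qbr q (int m - h - 1) = c * (1 - e)" "qbr q (int m - h) = c * (1 - e * q)"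
      "qbr q (int m + 1 - h) = c * (1 - e * q * q)"
  proof -
    have eqs: "q powi (k + 1) = q powi k * q" "q powi (k + 2) = q powi k * q * q" for k
      using q0 by (simp_all add: power_int_add power2_eq_square mult_ac)
    show "qbr q (int m - h - 1) = c * (1 - e)" by (simp add: br e_def)
    show "qbr q (int m - h) = c * (1 - e * q)" "qbr q (int m + 1 - h) = c * (1 - e * q * q)"
      using eqs[of "int m - h - 1"] by (simp_all add: br e_def algebra_simps)
  qed
  have v: "qbr q (int m + h + 1) = c * (1 - q * e * b * b * q)"
      "qbr q (int m + h + 2) = c * (1 - q * e * b * b * q * q)"
      "qbr q (int m + h + 3) = c * (1 - q * e * b * b * q * q * q)"
  proof -
    have eqs: "int m + h + 2 = int m + h + 1 + 1" "int m + h + 3 = int m + h + 1 + 1 + 1" by simp_all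
    show "qbr q (int m + h + 1) = c * (1 - q * e * b * b * q)"
      "qbr q (int m + h + 2) = c * (1 - q * e * b * b * q * q)"
      "qbr q (int m + h + 3) = c * (1 - q * e * b * b * q * q * q)"
      unfolding eqs br pa[symmetric] using q0
      by (simp_all only: power_int_add simp_thms power_int_1_right power_int_of_nat b_def)
  qed
  have idx: "int (Suc m) - h = int m + 1 - h" "int (Suc m) + h + 1 = int m + h + 2"
    "int m + 1 - h - 1 = int m - h" "int (Suc m) + h + 2 = int m + h + 3"
    "int m - (h - 1) = int m + 1 - h" "int m + (h - 1) + 1 = int m + h"
    "int m - (h - 1) - 1 = int m - h" "int m + (h - 1) + 2 = int m + h + 1"
    "int m - (h + 1) = int m - h - 1" "int m + (h + 1) + 1 = int m + h + 2"
    "int m + (h + 1) + 2 = int m + h + 3" by simp_all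
  have X1: "qinvfact q (int m - h) = c * (1 - e * q * q) * X"
    unfolding X_def u(3)[symmetric] using qinvfact_diff_1[OF q, of "int m + 1 - h"]
    by (simp add: algebra_simps)
  have X2: "qinvfact q (int m - h - 1) = c * (1 - e * q) * (c * (1 - e * q * q) * X)"
    unfolding X1[symmetric] u(2)[symmetric] by (rule qinvfact_diff_1[OF q])
  have X3: "qinvfact q (int m - h - 1 - 1) = c * (1 - e) * (c * (1 - e * q) * (c * (1 - e * q * q) * X))"
    unfolding X2[symmetric] u(1)[symmetric] by (rule qinvfact_diff_1[OF q])
  have Y1: "qinvfact q (int m + h + 2) = c * (1 - q * e * b * b * q * q * q) * Y"
    unfolding Y_def v(3)[symmetric] using qinvfact_diff_1[OF q, of "int m + h + 3"] by (simp add: add_ac)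
  have Y2: "qinvfact q (int m + h + 1) =
      c * (1 - q * e * b * b * q * q) * (c * (1 - q * e * b * b * q * q * q) * Y)"
    unfolding Y1[symmetric] v(2)[symmetric] using qinvfact_diff_1[OF q, of "int m + h + 2"] by (simp add: add_ac)
  have Y3: "qinvfact q (int m + h) = c * (1 - q * e * b * b * q) *
      (c * (1 - q * e * b * b * q * q) * (c * (1 - q * e * b * b * q * q * q) * Y))"
    unfolding Y2[symmetric] v(1)[symmetric] using qinvfact_diff_1[OF q, of "int m + h + 1"] by (simp add: add_ac)
  define B where "B = b * b"
  define U where "U = 1 - e" define U0 where "U0 = 1 - e * q" define U1 where "U1 = 1 - e * q * q"
  define V where "V = 1 - q * e * B * q" define V2 where "V2 = 1 - q * e * B * q * q"
  define V3 where "V3 = 1 - q * e * B * q * q * q"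
  define K where "K = z * F * (c * c * c) * X * Y"
  have Bb: "q * e * b * b = q * e * B" by (simp add: B_def mult_ac)
  have AA: "q * e * b * q * (q * e * b * q) = q * q * q * q * e * e * B" by (simp add: B_def mult_ac)
  \<comment> \<open>All six terms share the factor \<open>K\<close>; without it the two identities \<open>p1\<close>, \<open>p2\<close> involve \<open>q\<close>, \<open>e\<close> and \<open>B\<close> only.\<close>
  have t1: "close_gf q (Suc m) h = K * (b * ((1 - q * q * q * q * e * e * B) * (1 - q * q * q * q * e * e * B * q))
       * (V3 - q * B * U1))"
    unfolding close_gf_def F2 pz idx X1 Y1 Bb AA X_def[symmetric] Y_def[symmetric]
      V3_def[symmetric] U1_def[symmetric] K_def unfolding B_def by algebra
  have t2: "open_gf q (Suc m) h = K * (B * q * ((1 - q * q * q * q * e * e * B) * (1 - q * q * q * q * e * e * B * q))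
       * (V3 - q * q * B * U1))"
    unfolding open_gf_def F2 pz idx X1 Y1 Bb AA X_def[symmetric] Y_def[symmetric]
      V3_def[symmetric] U1_def[symmetric] K_def unfolding B_def by algebra
  have t3: "open_gf q m (h - 1) = K * (V3 * V2 * (V - B * U1))"
    unfolding open_gf_def pz idx X1 Y1 Y2 Y3 Bb X_def[symmetric] Y_def[symmetric] F_def[symmetric]
      V_def[symmetric] V2_def[symmetric] V3_def[symmetric] U1_def[symmetric] K_def unfolding B_def by algebra
  have t4: "close_gf q m h = K * (b * U1 * V3 * (V2 - q * B * U0))"
    unfolding close_gf_def pz idx X1 X2 Y1 Y2 Bb X_def[symmetric] Y_def[symmetric] F_def[symmetric]
      V2_def[symmetric] V3_def[symmetric] U0_def[symmetric] U1_def[symmetric] K_def unfolding B_def by algebra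
  have t5: "open_gf q m h = K * (B * q * U1 * V3 * (V2 - q * q * B * U0))"
    unfolding open_gf_def pz idx X1 X2 Y1 Y2 Bb X_def[symmetric] Y_def[symmetric] F_def[symmetric]
      V2_def[symmetric] V3_def[symmetric] U0_def[symmetric] U1_def[symmetric] K_def unfolding B_def by algebra
  have t6: "close_gf q m (h + 1) = K * (b * B * q * q * U0 * U1 * (V3 - q * q * q * B * U))"
    unfolding close_gf_def pz idx X1 X2 X3 Y1 Bb X_def[symmetric] Y_def[symmetric] F_def[symmetric]
      V3_def[symmetric] U_def[symmetric] U0_def[symmetric] U1_def[symmetric] K_def unfolding B_def by algebra
  have p1: "(1 - q * q * q * q * e * e * B) * (1 - q * q * q * q * e * e * B * q) * (V3 - q * B * U1)
     = q * e * q * (V3 * V2 * (V - B * U1)) + U1 * V3 * (V2 - q * B * U0)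
      + q * e * q * (B * q * U1 * V3 * (V2 - q * q * B * U0))
      + q * q * q * q * e * e * B * (B * q * q * U0 * U1 * (V3 - q * q * q * B * U))"
    unfolding V_def V2_def V3_def U_def U0_def U1_def by algebra
  have p2: "q * ((1 - q * q * q * q * e * e * B) * (1 - q * q * q * q * e * e * B * q)) * (V3 - q * q * B * U1)
     = q * q * q * q * q * e * e * (V3 * V2 * (V - B * U1)) + q * e * q * q * (U1 * V3 * (V2 - q * B * U0))
      + q * U1 * V3 * (V2 - q * q * B * U0)
      + q * e * q * (B * q * q * U0 * U1 * (V3 - q * q * q * B * U))"
    unfolding V_def V2_def V3_def U_def U0_def U1_def by algebra
  have "close_gf q (Suc m) h = K * b * ((1 - q * q * q * q * e * e * B) * (1 - q * q * q * q * e * e * B * q) * (V3 - q * B * U1))"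
    unfolding t1 by (simp only: mult_ac)
  also have "\<dots> = q ^ (m + 1) * open_gf q m (h - 1) + close_gf q m h
            + q ^ (m + 1) * open_gf q m h + q ^ (2 * m + 2) * close_gf q m (h + 1)"
    unfolding p1 t3 t4 t5 t6 pow AA by (simp add: distrib_left mult_ac)
  finally show "close_gf q (Suc m) h = q ^ (m + 1) * open_gf q m (h - 1) + close_gf q m h
            + q ^ (m + 1) * open_gf q m h + q ^ (2 * m + 2) * close_gf q m (h + 1)" .
  have "open_gf q (Suc m) h = K * B * (q * ((1 - q * q * q * q * e * e * B) * (1 - q * q * q * q * e * e * B * q)) * (V3 - q * q * B * U1))"
    unfolding t2 by (simp only: mult_ac)
  also have "\<dots> = q ^ (2 * m + 3) * open_gf q m (h - 1) + q ^ (m + 2) * close_gf q m h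
            + open_gf q m h + q ^ (m + 1) * close_gf q m (h + 1)"
    unfolding p2 t3 t4 t5 t6 pow AA by (simp add: distrib_left mult_ac B_def)
  finally show "open_gf q (Suc m) h = q ^ (2 * m + 3) * open_gf q m (h - 1) + q ^ (m + 2) * close_gf q m h
            + open_gf q m h + q ^ (m + 1) * close_gf q m (h + 1)" .
qed


lemma linear_gf_0:
  assumes "qgeneric q" "h \<ge> -1"
  shows "linear_gf q 0 h = (if h = 0 then 1 else 0)"
proof -
  have "qint q (Suc (Suc 0)) = 1 + q" by (simp add: qint_def)
  moreover have "1 + q \<noteq> 0" using qint_conv_qbr[OF assms(1), of 2] qbr_nonzero[OF assms(1), of 2]
    by (simp add: qint_def numeral_2_eq_2)
  moreover have "qint q (Suc 0) = 1" by (simp add: qint_def)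
  moreover have "qfact q 0 = 1" by (simp add: qfact_def)
  moreover have "q \<noteq> 1" using assms unfolding qgeneric_def by (metis power_one_right zero_less_one)
  moreover have "h = -1 \<or> h = 0 \<or> h > 0" using assms(2) by linarith
  ultimately show ?thesis
    unfolding linear_gf_def by (elim disjE) (simp_all add: qinvfact_def qbr_def qfact_Suc numeral_2_eq_2)
qed

text \<open>The boundary value that encodes the ballot condition: a path may not reach excess \<open>-1\<close>.\<close>

lemma linear_gf_minus1: "linear_gf q m (-1) = 0"
  by (simp add: linear_gf_def qbr_def)

lemma close_open_gf_0:
  assumes "h \<ge> 0"
  shows "close_gf q 0 h = (if h = 0 then 1 else 0)" "open_gf q 0 h = (if h = 0 then q else 0)"
proof -
  have *: "qint q (Suc 0) = 1" "qfact q 0 = 1" by (simp_all add: qint_def qfact_def)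
  consider "h = 0" | "h > 0" using assms by linarith
  then show "close_gf q 0 h = (if h = 0 then 1 else 0)" "open_gf q 0 h = (if h = 0 then q else 0)"
    unfolding close_gf_def open_gf_def by (cases; simp add: * qinvfact_def qfact_Suc)+
qed

lemma open_gf_minus1: "open_gf q m (-1) = 0"
  by (simp add: open_gf_def add.commute)

lemma linear_gf_q_catalan:
  assumes q: "qgeneric q"
  shows "linear_gf q m 0 = 1 / qint q (m + 2) * qbinomial q (2 * (m + 1)) (m + 1)"
proof -
  have nz: "qint q (Suc k) \<noteq> 0" for k
    by (simp add: qint_conv_qbr[OF q] qbr_nonzero[OF q])
  have split: "qint q (2 * m + 2) = (1 + q ^ (m + 1)) * qint q (m + 1)"
  proof -
    have "qint q (2 * m + 2) = (1 - (q ^ (m + 1))\<^sup>2) / (1 - q)"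
      by (simp only: qint_conv_qbr[OF q] qbr_def power_int_of_nat power_mult[symmetric]) (simp add: algebra_simps)
    also have "\<dots> = (1 + q ^ (m + 1)) * ((1 - q ^ (m + 1)) / (1 - q))"
      by (simp add: power2_eq_square algebra_simps)
    finally show ?thesis by (simp only: qint_conv_qbr[OF q] qbr_def power_int_of_nat)
  qed
  have "linear_gf q m 0 = (1 + q ^ (m + 1)) * qfact q (2 * m + 1) / (qfact q m * qfact q (m + 2))"
    using nz[of 0] unfolding linear_gf_def
    by (simp add: qinvfact_def divide_simps nat_add_distrib qbr_def qint_def)
       (use q in \<open>auto simp: qgeneric_def\<close>)
  also have "\<dots> = 1 / qint q (m + 2) * qbinomial q (2 * (m + 1)) (m + 1)"
    using split nz[of m] nz[of "Suc m"] qfact_nonzero[OF q, of m]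
    by (simp add: qbinomial_def qfact_Suc divide_simps)
  finally show ?thesis .
qed

lemma close_gf_eq_linear_gf:
  assumes q: "qgeneric q"
  shows "close_gf q m 0 = linear_gf q m 0"
proof -
  have q1: "1 - q \<noteq> 0" using assms unfolding qgeneric_def by (metis power_one_right zero_less_one eq_iff_diff_eq_0)
  define Y where "Y = qinvfact q (int m + 2)"
  have "qinvfact q (int m + 1) = qbr q (int m + 2) * Y" "qinvfact q (int m - 1) = qbr q (int m) * qinvfact q (int m)"
    using qinvfact_diff_1[OF q, of "int m + 2"] qinvfact_diff_1[OF q, of "int m"]
    by (simp_all add: Y_def add_ac)
  then have "close_gf q m 0 = qfact q (2 * m + 1) * qinvfact q (int m) * Y * (qbr q (int m + 2) - q * qbr q (int m))"
    by (simp add: close_gf_def Y_def algebra_simps)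
  also have "qbr q (int m + 2) - q * qbr q (int m) = 1 + q ^ (m + 1)"
  proof -
    have "q powi (int m + 2) = q ^ m * q * q"
      using power_int_of_nat[of q "m + 2"] by (simp add: mult_ac add_ac)
    then have "qbr q (int m + 2) - q * qbr q (int m) = (1 - q ^ m * q * q - q * (1 - q ^ m)) / (1 - q)"
      by (simp add: qbr_def diff_divide_distrib right_diff_distrib)
    also have "1 - q ^ m * q * q - q * (1 - q ^ m) = (1 + q ^ (m + 1)) * (1 - q)"
      by (simp add: algebra_simps)
    finally show ?thesis using q1 by simp
  qed
  finally show ?thesis using q1 by (simp add: linear_gf_def Y_def qbr_def)
qed

lemma qgeneric_qvar: "qgeneric qvar"
proof -
  have "to_fract ([:0, 1:] ^ k) \<noteq> to_fract (1 :: int poly)" if "k > 0" for k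
  proof -
    have "degree ([:0, 1:] ^ k :: int poly) = k" by (simp add: degree_power_eq)
    then have "([:0, 1:] ^ k :: int poly) \<noteq> 1" using that by (metis degree_1 less_numeral_extra(3))
    then show ?thesis unfolding to_fract_def by (simp add: eq_fract)
  qed
  moreover have "to_fract (p ^ k) = to_fract p ^ k" for p :: "int poly" and k
    by (induction k) simp_all
  ultimately show ?thesis unfolding qgeneric_def qvar_def by (auto simp: to_fract_eq_0_iff)
qed

section \<open>Ballot pairs\<close>

text \<open>The height of the path after step \<open>i\<close>, where \<open>I\<close> marks its rises and \<open>J\<close> its falls (positions in
  both or in neither are level).\<close>

definition excess :: "nat set \<Rightarrow> nat set \<Rightarrow> nat \<Rightarrow> int" where
  "excess I J i = int (card (I \<inter> {1..i})) - int (card (J \<inter> {1..i}))"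

definition ballot :: "nat \<Rightarrow> int \<Rightarrow> (nat set \<times> nat set) set" where
  "ballot m h = {(I, J). I \<subseteq> {1..m} \<and> J \<subseteq> {1..m} \<and> (\<forall>i\<le>m. 0 \<le> excess I J i) \<and> excess I J m = h}"

lemma excess_0 [simp]: "excess I J 0 = 0"
  by (simp add: excess_def)

lemma excess_Suc:
  "excess I J (Suc i) = excess I J i + of_bool (Suc i \<in> I) - of_bool (Suc i \<in> J)"
proof -
  have "int (card (K \<inter> {1..Suc i})) = int (card (K \<inter> {1..i})) + of_bool (Suc i \<in> K)" for K :: "nat set"
  proof (cases "Suc i \<in> K")
    case True
    then have "K \<inter> {1..Suc i} = insert (Suc i) (K \<inter> {1..i})" by auto
    then show ?thesis using True by (simp add: card_insert_if)
  next
    case False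
    then have "K \<inter> {1..Suc i} = K \<inter> {1..i}" by (auto simp: le_Suc_eq)
    then show ?thesis using False by simp
  qed
  then show ?thesis by (simp add: excess_def)
qed

lemma excess_cong:
  assumes "\<And>k. 1 \<le> k \<Longrightarrow> k \<le> i \<Longrightarrow> k \<in> I \<longleftrightarrow> k \<in> I'" "\<And>k. 1 \<le> k \<Longrightarrow> k \<le> i \<Longrightarrow> k \<in> J \<longleftrightarrow> k \<in> J'"
  shows "excess I J i = excess I' J' i"
proof -
  have "I \<inter> {1..i} = I' \<inter> {1..i}" "J \<inter> {1..i} = J' \<inter> {1..i}" using assms by auto
  then show ?thesis by (simp add: excess_def)
qed

lemma finite_ballot: "finite (ballot m h)"
  by (rule finite_subset[of _ "Pow {1..m} \<times> Pow {1..m}"]) (auto simp: ballot_def)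

lemma ballot_neg: "h < 0 \<Longrightarrow> ballot m h = {}"
  by (auto simp: ballot_def)

lemma ballot_0: "ballot 0 h = (if h = 0 then {({}, {})} else {})"
  by (auto simp: ballot_def)

definition ballot_ext :: "nat \<Rightarrow> bool \<Rightarrow> bool \<Rightarrow> nat set \<times> nat set \<Rightarrow> nat set \<times> nat set" where
  "ballot_ext m x y = (\<lambda>(I, J). (if x then insert (Suc m) I else I, if y then insert (Suc m) J else J))"

lemma ballot_ext_in:
  assumes "p \<in> ballot m k" "h = k + of_bool x - of_bool y" "h \<ge> 0"
  shows "ballot_ext m x y p \<in> ballot (Suc m) h"
proof -
  obtain I J where p: "p = (I, J)" by (cases p)
  define I' where "I' = (if x then insert (Suc m) I else I)"
  define J' where "J' = (if y then insert (Suc m) J else J)"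
  have sub: "I \<subseteq> {1..m}" "J \<subseteq> {1..m}" and ex: "\<And>i. i \<le> m \<Longrightarrow> 0 \<le> excess I J i" "excess I J m = k"
    using assms(1) by (auto simp: p ballot_def)
  have eq: "excess I' J' i = excess I J i" if "i \<le> m" for i
    by (rule excess_cong) (use that in \<open>auto simp: I'_def J'_def\<close>)
  have top: "excess I' J' (Suc m) = h"
    unfolding excess_Suc eq[OF order_refl] ex(2) assms(2)
    using sub by (auto simp: I'_def J'_def)
  have "\<forall>i\<le>Suc m. 0 \<le> excess I' J' i"
    using eq ex(1) top assms(3) by (metis le_SucE)
  moreover have "I' \<subseteq> {1..Suc m}" "J' \<subseteq> {1..Suc m}" using sub by (auto simp: I'_def J'_def)
  ultimately show ?thesis
    using top by (auto simp: ballot_ext_def p ballot_def I'_def J'_def)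
qed

lemma ballot_ext_cases:
  assumes "p \<in> ballot (Suc m) h"
  obtains x y r where "r \<in> ballot m (h - of_bool x + of_bool y)" "p = ballot_ext m x y r"
proof -
  obtain I J where p: "p = (I, J)" by (cases p)
  define I' where "I' = I - {Suc m}"
  define J' where "J' = J - {Suc m}"
  have sub: "I \<subseteq> {1..Suc m}" "J \<subseteq> {1..Suc m}"
    and ex: "\<And>i. i \<le> Suc m \<Longrightarrow> 0 \<le> excess I J i" "excess I J (Suc m) = h"
    using assms(1) by (auto simp: p ballot_def)
  have eq: "excess I' J' i = excess I J i" if "i \<le> m" for i
    by (rule excess_cong) (use that in \<open>auto simp: I'_def J'_def\<close>)
  have "I' \<subseteq> {1..m}" "J' \<subseteq> {1..m}"
    using sub by (fastforce simp: I'_def J'_def le_Suc_eq)+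
  moreover have "\<forall>i\<le>m. 0 \<le> excess I' J' i" using eq ex(1) by auto
  moreover have "excess I' J' m = h - of_bool (Suc m \<in> I) + of_bool (Suc m \<in> J)"
    using eq[OF order_refl] ex(2) unfolding excess_Suc by linarith
  ultimately have "(I', J') \<in> ballot m (h - of_bool (Suc m \<in> I) + of_bool (Suc m \<in> J))"
    by (simp add: ballot_def)
  moreover have "p = ballot_ext m (Suc m \<in> I) (Suc m \<in> J) (I', J')"
    by (auto simp: p ballot_ext_def I'_def J'_def)
  ultimately show ?thesis using that by blast
qed

lemma ballot_ext_inj:
  assumes "p \<in> ballot m h" "p' \<in> ballot m h'" "ballot_ext m x y p = ballot_ext m x' y' p'"
  shows "x = x'" "y = y'" "p = p'"
proof -
  obtain I J I' J' where p: "p = (I, J)" "p' = (I', J')" by (metis surj_pair)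
  have n: "Suc m \<notin> I" "Suc m \<notin> J" "Suc m \<notin> I'" "Suc m \<notin> J'" using assms(1,2) by (auto simp: p ballot_def)
  show "x = x'" "y = y'" "p = p'"
    using assms(3) n by (auto simp: p ballot_ext_def insert_ident split: if_splits)
qed

text \<open>The last position contributes to neither set, to both, to \<open>I\<close> only or to \<open>J\<close> only. The excess
  needs to be checked at the new position only, where it is \<open>h\<close>.\<close>

lemma sum_ballot_Suc:
  fixes f :: "nat set \<times> nat set \<Rightarrow> 'b::comm_monoid_add"
  assumes "h \<ge> 0"
  shows "sum f (ballot (Suc m) h) =
     (\<Sum>p\<in>ballot m h. f (ballot_ext m False False p)) + (\<Sum>p\<in>ballot m h. f (ballot_ext m True True p))
     + (\<Sum>p\<in>ballot m (h - 1). f (ballot_ext m True False p))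
     + (\<Sum>p\<in>ballot m (h + 1). f (ballot_ext m False True p))"
proof -
  define part where "part x y = ballot_ext m x y ` ballot m (h - of_bool x + of_bool y)" for x y
  have fin: "finite (part x y)" for x y by (simp add: part_def finite_ballot)
  have sub: "part x y \<subseteq> ballot (Suc m) h" for x y
    unfolding part_def by (auto intro!: ballot_ext_in[where k = "h - of_bool x + of_bool y"] simp: assms)
  have cov: "ballot (Suc m) h = part False False \<union> part True True \<union> part True False \<union> part False True"
  proof
    show "ballot (Suc m) h \<subseteq> part False False \<union> part True True \<union> part True False \<union> part False True"
    proof
      fix p assume "p \<in> ballot (Suc m) h"
      then obtain x y where "p \<in> part x y" unfolding part_def by (metis ballot_ext_cases image_eqI)
      then show "p \<in> part False False \<union> part True True \<union> part True False \<union> part False True"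
        by (cases x; cases y) auto
    qed
  qed (use sub in blast)
  have disj: "part x y \<inter> part x' y' = {}" if "(x, y) \<noteq> (x', y')" for x y x' y'
    using that ballot_ext_inj(1,2) unfolding part_def by blast
  have s: "sum f (part x y) = (\<Sum>p\<in>ballot m (h - of_bool x + of_bool y). f (ballot_ext m x y p))" for x y
    unfolding part_def
    by (subst sum.reindex) (auto intro!: inj_onI dest: ballot_ext_inj(3))
  have "sum f (ballot (Suc m) h) = sum f (part False False) + sum f (part True True)
     + sum f (part True False) + sum f (part False True)"
    unfolding cov using disj fin by (simp add: sum.union_disjoint Int_Un_distrib2)
  then show ?thesis unfolding s by simp
qed

section \<open>The linear weight on ballot pairs\<close>

definition linear_wt :: "nat set \<times> nat set \<Rightarrow> nat" where
  "linear_wt p = \<Sum>(fst p) + \<Sum>(snd p)"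

lemma linear_wt_ext:
  assumes "p \<in> ballot m h"
  shows "linear_wt (ballot_ext m x y p) = linear_wt p + of_bool x * Suc m + of_bool y * Suc m"
proof -
  obtain I J where p: "p = (I, J)" by (cases p)
  have "finite I" "finite J" "Suc m \<notin> I" "Suc m \<notin> J"
    using assms by (auto simp: p ballot_def dest: finite_subset)
  then show ?thesis by (auto simp: linear_wt_def ballot_ext_def p)
qed

lemma sum_linear_wt:
  assumes "qgeneric q" "h \<ge> -1"
  shows "(\<Sum>p\<in>ballot m h. q ^ linear_wt p) = linear_gf q m h"
  using assms(2)
proof (induction m arbitrary: h)
  case 0
  then show ?case by (simp add: linear_gf_0[OF assms(1)] ballot_0 linear_wt_def)
next
  case (Suc m)
  show ?case
  proof (cases "h = -1")
    case True
    then show ?thesis by (simp add: ballot_neg linear_gf_minus1)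
  next
    case False
    then have h: "h \<ge> 0" using Suc.prems by simp
    have ext: "(\<Sum>p\<in>ballot m k. q ^ linear_wt (ballot_ext m x y p)) =
        q ^ (of_bool x * Suc m) * q ^ (of_bool y * Suc m) * (\<Sum>p\<in>ballot m k. q ^ linear_wt p)" for k x y
      unfolding sum_distrib_left
      by (intro sum.cong refl) (simp add: linear_wt_ext power_add mult_ac del: power_Suc)
    have "q ^ (2 * m + 2) = q ^ Suc m * q ^ Suc m" by (simp only: power_add[symmetric] mult_2) (rule arg_cong[of _ _ "(^) q"], simp)
    then show ?thesis
      unfolding sum_ballot_Suc[OF h] ext linear_gf_rec[OF assms(1)]
      using h Suc.IH[of h] Suc.IH[of "h - 1"] Suc.IH[of "h + 1"]
      by (simp add: algebra_simps del: power_Suc)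
  qed
qed

section \<open>The weight on ballot pairs that comes from noncrossing partitions\<close>

text \<open>A noncrossing partition of \<open>{1..m+1}\<close> is read from left to right as the bits
  ``1 opens a block'', ``1 closes a block'', ``2 opens a block'', and so on, where the first bit is
  always true; \<open>k \<in> I\<close> says that \<open>k + 1\<close> opens a block and \<open>k \<in> J\<close> that \<open>k\<close> closes one. The
  contribution of a descent is charged to a pair of consecutive bits. The first conditional
  belongs to ``\<open>k+1\<close> opens'' followed by ``\<open>k+1\<close> closes'', the second to ``\<open>k+1\<close> closes''
  followed by ``\<open>k+2\<close> opens''. The test \<open>k = 0\<close> stands for the first bit.\<close>

fun scan_wt :: "nat \<Rightarrow> nat set \<times> nat set \<Rightarrow> nat" where
  "scan_wt 0 p = 0"
| "scan_wt (Suc k) p = scan_wt k p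
     + (if k = 0 \<or> k \<in> fst p then (if Suc k \<in> snd p then 0 else Suc k) else (if Suc k \<in> snd p then k else 0))
     + (if Suc k \<in> fst p \<longleftrightarrow> Suc k \<in> snd p then 0 else Suc k)"

text \<open>The weight of the bits read so far once the next bit is fixed: in \<open>close_wt\<close> the point \<open>m + 1\<close>
  closes its block, in \<open>open_wt\<close> it does not. For a complete partition \<open>m + 1\<close> is the last point, which
  closes its block, so that \<open>close_wt\<close> is the total weight.\<close>

definition close_wt :: "nat \<Rightarrow> nat set \<times> nat set \<Rightarrow> nat" where
  "close_wt m p = scan_wt m p + (if m = 0 \<or> m \<in> fst p then 0 else m)"

definition open_wt :: "nat \<Rightarrow> nat set \<times> nat set \<Rightarrow> nat" where
  "open_wt m p = scan_wt m p + (if m = 0 \<or> m \<in> fst p then Suc m else 0)"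

lemma scan_wt_ext:
  assumes "k \<le> m"
  shows "scan_wt k (ballot_ext m x y p) = scan_wt k p"
  using assms by (induction k) (auto simp: ballot_ext_def split: prod.splits)

lemma scan_wt_ext_Suc:
  assumes "p \<in> ballot m h"
  shows "scan_wt (Suc m) (ballot_ext m x y p) =
      (if y then close_wt m p else open_wt m p) + (if x = y then 0 else Suc m)"
proof -
  obtain I J where p: "p = (I, J)" by (cases p)
  have "Suc m \<notin> I" "Suc m \<notin> J"
    using assms by (auto simp: p ballot_def dest: finite_subset)
  then show ?thesis using scan_wt_ext[of m m x y p]
    by (auto simp: close_wt_def open_wt_def ballot_ext_def p)
qed

lemma close_open_wt_ext:
  assumes "p \<in> ballot m h"
  shows "close_wt (Suc m) (ballot_ext m x y p) =
      (if y then close_wt m p else open_wt m p) + (if x = y then 0 else Suc m) + (if x then 0 else Suc m)"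
    and "open_wt (Suc m) (ballot_ext m x y p) =
      (if y then close_wt m p else open_wt m p) + (if x = y then 0 else Suc m) + (if x then m + 2 else 0)"
proof -
  obtain I J where p: "p = (I, J)" by (cases p)
  have "Suc m \<notin> I" using assms by (auto simp: p ballot_def dest: finite_subset)
  then have "Suc m \<in> fst (ballot_ext m x y p) \<longleftrightarrow> x" by (simp add: p ballot_ext_def)
  then show "close_wt (Suc m) (ballot_ext m x y p) =
      (if y then close_wt m p else open_wt m p) + (if x = y then 0 else Suc m) + (if x then 0 else Suc m)"
    "open_wt (Suc m) (ballot_ext m x y p) =
      (if y then close_wt m p else open_wt m p) + (if x = y then 0 else Suc m) + (if x then m + 2 else 0)"
    unfolding close_wt_def[of "Suc m"] open_wt_def[of "Suc m"] scan_wt_ext_Suc[OF assms] by simp_all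
qed

text \<open>A new position consists of a closing bit \<open>y\<close> followed by an opening bit \<open>x\<close>. The bit \<open>y\<close> decides whether
  \<open>close_wt\<close> or \<open>open_wt\<close> of the shorter pair is continued, and so the two sums satisfy a coupled
  recurrence.\<close>

lemma sum_close_open_wt:
  assumes "qgeneric q"
  shows "h \<ge> 0 \<Longrightarrow> (\<Sum>p\<in>ballot m h. q ^ close_wt m p) = close_gf q m h"
    and "h \<ge> -1 \<Longrightarrow> (\<Sum>p\<in>ballot m h. q ^ open_wt m p) = open_gf q m h"
proof (induction m arbitrary: h)
  case 0
  { case 1 then show ?case by (simp add: close_open_gf_0 ballot_0 close_wt_def) }
  { case 2 then show ?case
      by (cases "h = -1") (simp_all add: close_open_gf_0 open_gf_minus1 ballot_0 open_wt_def) }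
next
  case (Suc m)
  have ext: "(\<Sum>p\<in>ballot m k. q ^ close_wt (Suc m) (ballot_ext m x y p)) =
        q ^ (if x = y then 0 else Suc m) * q ^ (if x then 0 else Suc m)
          * (\<Sum>p\<in>ballot m k. q ^ (if y then close_wt m p else open_wt m p))"
     "(\<Sum>p\<in>ballot m k. q ^ open_wt (Suc m) (ballot_ext m x y p)) =
        q ^ (if x = y then 0 else Suc m) * q ^ (if x then m + 2 else 0)
          * (\<Sum>p\<in>ballot m k. q ^ (if y then close_wt m p else open_wt m p))" for k x y
      unfolding sum_distrib_left
      by (intro sum.cong refl; simp only: close_open_wt_ext power_add mult_ac)+
  have pw: "q ^ (2 * m + 2) = q ^ Suc m * q ^ Suc m" "q ^ (2 * m + 3) = q ^ Suc m * q ^ (m + 2)"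
    by (simp_all flip: power_add power_Suc add: numeral_eq_Suc)
  { case 1
    then show ?case
      unfolding sum_ballot_Suc[OF 1] ext close_open_gf_rec[OF assms] pw
      using Suc.IH(1)[of h] Suc.IH(2)[of h] Suc.IH(2)[of "h - 1"] Suc.IH(1)[of "h + 1"]
      by (simp add: algebra_simps del: power_Suc) }
  { case 2
    show ?case
    proof (cases "h = -1")
      case True
      then show ?thesis by (simp add: ballot_neg open_gf_minus1)
    next
      case False
      then have h: "h \<ge> 0" using 2 by simp
      then show ?thesis
        unfolding sum_ballot_Suc[OF h] ext close_open_gf_rec[OF assms] pw
        using Suc.IH(1)[of h] Suc.IH(2)[of h] Suc.IH(2)[of "h - 1"] Suc.IH(1)[of "h + 1"]
        by (simp add: algebra_simps del: power_Suc)
    qed }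
qed

section \<open>Noncrossing permutations\<close>

lemma cycle_of_sorted_list_of_set:
  fixes B :: "'a::linorder set"
  assumes "finite B" "i \<in> B"
  defines "s \<equiv> cycle_of_list (sorted_list_of_set B)"
  shows "s i \<in> B" "\<And>j. j \<in> B \<Longrightarrow> i < j \<Longrightarrow> i < s i \<and> s i \<le> j"
    "(\<And>j. j \<in> B \<Longrightarrow> j \<le> i) \<Longrightarrow> j \<in> B \<Longrightarrow> s i \<le> j"
proof -
  define xs where "xs = sorted_list_of_set B"
  have xs: "distinct xs" "sorted_wrt (<) xs" "set xs = B" using assms(1) by (simp_all add: xs_def)
  have mp: "map s xs = rotate1 xs"
    using cyclic_rotation[OF xs(1), of 1] unfolding s_def xs_def by simp
  obtain k where k: "k < length xs" "i = xs ! k" using assms(2) xs(3) by (metis in_set_conv_nth)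
  have si: "s i = xs ! (Suc k mod length xs)"
    using arg_cong[OF mp, of "\<lambda>l. l ! k"] k nth_rotate1[OF k(1)] by simp
  then show "s i \<in> B" using k xs(3) by (metis mod_less_divisor nth_mem not_less_zero gr_zeroI)
  show "i < s i \<and> s i \<le> j" if j: "j \<in> B" "i < j" for j
  proof -
    obtain l where l: "l < length xs" "j = xs ! l" using j xs(3) by (metis in_set_conv_nth)
    have "k < l" using xs(2) j(2) k l by (metis linorder_cases order_less_asym sorted_wrt_nth_less)
    then have "s i = xs ! Suc k" using si l by simp
    moreover have "xs ! k < xs ! Suc k" using xs(2) \<open>k < l\<close> l by (simp add: sorted_wrt_nth_less)
    moreover have "xs ! Suc k \<le> xs ! l"
      using xs(2) \<open>k < l\<close> l by (metis Suc_leI le_neq_implies_less order.refl order_less_imp_le sorted_wrt_nth_less)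
    ultimately show ?thesis using k l by simp
  qed
  show "s i \<le> j" if mx: "\<And>j. j \<in> B \<Longrightarrow> j \<le> i" and j: "j \<in> B" for j
  proof -
    obtain l where l: "l < length xs" "j = xs ! l" using j xs(3) by (metis in_set_conv_nth)
    have "\<not> Suc k < length xs"
    proof
      assume a: "Suc k < length xs"
      then have "xs ! Suc k \<le> i" using mx xs(3) nth_mem by blast
      moreover have "xs ! k < xs ! Suc k" using xs(2) a by (simp add: sorted_wrt_nth_less)
      ultimately show False using k by simp
    qed
    then have "Suc k = length xs" using k by simp
    then have "s i = xs ! 0" using si by simp
    then show ?thesis using xs(2) l by (metis gr0I order.order_iff_strict sorted_wrt_nth_less)
  qed
qed

text \<open>Otherwise \<open>j\<close> and \<open>k\<close> would interleave with \<open>a\<close> and \<open>b\<close>.\<close>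

lemma noncrossing_separated:
  assumes "noncrossing P" "B \<in> P" "C \<in> P" "B \<inter> C = {}" "a \<in> B" "b \<in> B" "j \<in> C" "k \<in> C" "a < j" "j < b"
  shows "a < k \<and> k < b"
proof (rule ccontr)
  assume "\<not> (a < k \<and> k < b)"
  moreover have "k \<noteq> a" "k \<noteq> b" "B \<noteq> C" using assms by auto
  ultimately have "k < a \<or> b < k" by auto
  then show False using assms \<open>B \<noteq> C\<close> unfolding noncrossing_def by (metis)
qed

text \<open>The properties of a noncrossing permutation that the rest uses, free of blocks: points under an arc
  \<open>i \<mapsto> s i\<close> stay under it; points between the ends of a block stay there; and
  the first point of a block with more than one point is not its last.\<close>

definition nested :: "nat \<Rightarrow> (nat \<Rightarrow> nat) \<Rightarrow> bool" where
  "nested n s \<longleftrightarrow> s permutes {1..n} \<and>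
     (\<forall>i j. i < j \<and> j < s i \<longrightarrow> i < s j \<and> s j < s i \<and> i < inv s j \<and> inv s j < s i) \<and>
     (\<forall>i j. s i < j \<and> j < i \<longrightarrow> s i < s j \<and> s j \<le> i \<and> s i \<le> inv s j \<and> inv s j < i) \<and>
     (\<forall>i. s i < i \<longrightarrow> s i < s (s i) \<and> inv s i < i)"

lemma nestedD:
  assumes "nested n s"
  shows nested_permutes: "s permutes {1..n}"
    and nested_below_arc: "i < j \<Longrightarrow> j < s i \<Longrightarrow> i < s j \<and> s j < s i \<and> i < inv s j \<and> inv s j < s i"
    and nested_in_span: "s i < j \<Longrightarrow> j < i \<Longrightarrow> s i < s j \<and> s j \<le> i \<and> s i \<le> inv s j \<and> inv s j < i"
    and nested_block_end: "s i < i \<Longrightarrow> s i < s (s i) \<and> inv s i < i"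
  using assms unfolding nested_def by blast+

lemma NC_nested:
  assumes "s \<in> NC n"
  shows "nested n s"
proof -
  from assms obtain P where s: "s permutes {1..n}" and P: "partition_on {1..n} P" "noncrossing P"
    and cyc: "\<And>B i. B \<in> P \<Longrightarrow> i \<in> B \<Longrightarrow> s i = cycle_of_list (sorted_list_of_set B) i"
    unfolding NC_def by auto
  have fin: "finite B" if "B \<in> P" for B
    using P(1) that by (metis finite_atLeastAtMost finite_elements finite_UnionD partition_onD1 rev_finite_subset Union_upper)
  have c1: "s i \<in> B" if "B \<in> P" "i \<in> B" for B i
    using cycle_of_sorted_list_of_set(1)[OF fin that(2)] cyc that by simp
  have c2: "i < s i \<and> s i \<le> j" if "B \<in> P" "i \<in> B" "j \<in> B" "i < j" for B i j
    using cycle_of_sorted_list_of_set(2)[OF fin that(2-4)] cyc that by simp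
  have c3: "s i \<le> j" if "B \<in> P" "i \<in> B" "j \<in> B" "\<And>j. j \<in> B \<Longrightarrow> j \<le> i" for B i j
    using cycle_of_sorted_list_of_set(3)[OF fin that(2) that(4) that(3)] cyc that by simp
  have inj: "inj s" using s by (rule permutes_inj)
  have c4: "inv s i \<in> B" if B: "B \<in> P" "i \<in> B" for B i
  proof -
    have "s ` B \<subseteq> B" using c1 B by blast
    then have "s ` B = B" using fin[OF B(1)] inj by (metis card_image card_subset_eq inj_on_subset subset_UNIV)
    then obtain k where "k \<in> B" "i = s k" using B(2) by blast
    then show ?thesis using inj by simp
  qed
  have inv: "s (inv s j) = j" for j using s by (simp add: permutes_inverses)
  have blk: "\<exists>B\<in>P. i \<in> B" if "s j < i \<and> i < j \<or> j < i \<and> i < s j \<or> s i \<noteq> i" for i j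
  proof -
    have "i \<in> {1..n}"
    proof (cases "s i = i")
      case False
      then show ?thesis using s by (meson permutes_not_in)
    next
      case True
      then have "s j \<noteq> j" using that by auto
      then have "j \<in> {1..n}" "s j \<in> {1..n}" using s by (metis permutes_not_in, metis permutes_in_image permutes_not_in)
      then show ?thesis using that True by auto
    qed
    then show ?thesis using P(1) unfolding partition_on_def by blast
  qed
  have disj: "B \<inter> C = {}" if "B \<in> P" "C \<in> P" "B \<noteq> C" for B C
    using P(1) that unfolding partition_on_def disjoint_def by blast
  have n1: "i < s j \<and> s j < s i \<and> i < inv s j \<and> inv s j < s i" if ij: "i < j" "j < s i" for i j
  proof -
    obtain B where B: "B \<in> P" "i \<in> B" using blk[where i=i and j=i] ij by auto
    obtain C where C: "C \<in> P" "j \<in> C" using blk[where i=j and j=i] ij by blast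
    have "B \<noteq> C" using c2[OF B(1,2)] C(2) ij by fastforce
    then have "B \<inter> C = {}" using disj B C by blast
    note sep = noncrossing_separated[OF P(2) B(1) C(1) this B(2) c1[OF B] C(2) _ ij]
    from sep[OF c1[OF C]] sep[OF c4[OF C]] show ?thesis by blast
  qed
  have mx: "k \<le> i" if "s i < i" "B \<in> P" "i \<in> B" "k \<in> B" for i k B
    using c2[OF that(2,3,4)] that(1) by fastforce
  have n2: "s i < s j \<and> s j \<le> i \<and> s i \<le> inv s j \<and> inv s j < i" if ij: "s i < j" "j < i" for i j
  proof -
    obtain B where B: "B \<in> P" "i \<in> B" using blk[where i=i and j=i] ij by auto
    obtain C where C: "C \<in> P" "j \<in> C" using blk[where i=j and j=i] ij by blast
    show ?thesis
    proof (cases "B = C")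
      case True
      have "j < s j \<and> s j \<le> i" using c2[of B j i] B C ij True by blast
      moreover have "s i \<le> inv s j" using c3[OF B c4[OF C, folded True]] mx[OF _ B] ij by auto
      moreover have "inv s j \<le> i" using mx[OF _ B] c4[OF C, folded True] ij by auto
      moreover have "inv s j \<noteq> i" using inv[of j] ij by auto
      ultimately show ?thesis using ij by auto
    next
      case False
      then have "B \<inter> C = {}" using disj B C by blast
      note sep = noncrossing_separated[OF P(2) B(1) C(1) this c1[OF B] B(2) C(2) _ ij]
      from sep[OF c1[OF C]] sep[OF c4[OF C]] show ?thesis by auto
    qed
  qed
  have n3: "s i < s (s i) \<and> inv s i < i" if lt: "s i < i" for i
  proof -
    obtain B where B: "B \<in> P" "i \<in> B" using blk[where i=i and j=i] lt by auto
    have "s i < s (s i)" using c2[OF B(1) c1[OF B] B(2) lt] by blast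
    moreover have "inv s i \<le> i" using mx[OF lt B c4[OF B]] .
    moreover have "inv s i \<noteq> i" using inv[of i] lt by auto
    ultimately show ?thesis by auto
  qed
  show ?thesis unfolding nested_def
  proof (intro conjI allI impI)
    show "s permutes {1..n}" by (fact s)
  qed (use n1 n2 n3 in blast)+
qed

text \<open>The condition \<open>i \<le> inv s i\<close> says that \<open>i\<close> opens its block, and \<open>s i \<le> i\<close> that \<open>i\<close> closes it. The point
  1 always opens and the point \<open>m + 1\<close> always closes, so they are left out; opening points are moved
  down by one in order to obtain a ballot pair.\<close>

definition extremes :: "nat \<Rightarrow> (nat \<Rightarrow> nat) \<Rightarrow> nat set \<times> nat set" where
  "extremes m s = ({i \<in> {1..m}. Suc i \<le> inv s (Suc i)}, {i \<in> {1..m}. s i \<le> i})"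

text \<open>If \<open>i + 1\<close> closes a block that began earlier, it is sent to the first point of that block, which lies
  below everything that \<open>i\<close> can reach. If \<open>i\<close> does not close its block and \<open>i + 1\<close> opens one, then the
  arc from \<open>i\<close> passes over \<open>i + 1\<close> and everything in its block. In all other cases \<open>i\<close> is an ascent.\<close>

lemma nested_descent_iff:
  assumes "nested n s"
  shows "s (Suc i) < s i \<longleftrightarrow>
      s (Suc i) \<le> Suc i \<and> \<not> Suc i \<le> inv s (Suc i) \<or> \<not> s i \<le> i \<and> Suc i \<le> inv s (Suc i)"
proof -
  note s = nested_permutes[OF assms] and n1 = nested_below_arc[OF assms]
    and n2 = nested_in_span[OF assms] and n3 = nested_block_end[OF assms]
  have inv [simp]: "s (inv s j) = j" "inv s (s j) = j" for j using s by (simp_all add: permutes_inverses)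
  have neq: "s (Suc i) \<noteq> s i" by (metis inv(2) n_not_Suc_n)
  show ?thesis
  proof (cases "s (Suc i) \<le> Suc i \<and> \<not> Suc i \<le> inv s (Suc i)")
    case True
    then have a: "s (Suc i) < Suc i" by (metis inv(2) le_neq_implies_less order.refl)
    have "s (Suc i) < s i"
    proof (cases "s (Suc i) = i")
      case True
      then show ?thesis using n3[of "Suc i"] by auto
    next
      case False
      then show ?thesis using n2[of "Suc i" i] a by auto
    qed
    then show ?thesis using True by blast
  next
    case A: False
    show ?thesis
    proof (cases "\<not> s i \<le> i \<and> Suc i \<le> inv s (Suc i)")
      case True
      then have "s i \<noteq> Suc i" by (metis inv(2) not_less_eq_eq order.refl)
      then show ?thesis using True n1[of i "Suc i"] by auto
    next
      case B: False
      have "s i < s (Suc i)"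
      proof (cases "s (Suc i) \<le> Suc i")
        case False
        show ?thesis
        proof (cases "s i \<le> i")
          case True then show ?thesis using False by simp
        next
          case F2: False
          then have "inv s (Suc i) < Suc i" using B by simp
          show ?thesis
          proof (cases "s i = Suc i")
            case True then show ?thesis using False by simp
          next
            case F3: False
            then have "inv s (Suc i) < i" using \<open>inv s (Suc i) < Suc i\<close> by (metis inv(1) less_antisym)
            then have "s i < Suc i" using n1[of "inv s (Suc i)" i] by simp
            then show ?thesis using F2 by simp
          qed
        qed
      next
        case True
        then have a: "Suc i \<le> inv s (Suc i)" using A by blast
        then have "s i \<le> i" using B by blast
        moreover have "s (Suc i) = Suc i"
        proof (rule ccontr)
          assume "s (Suc i) \<noteq> Suc i"
          then have "s (Suc i) < Suc i" using True by simp
          then show False using n3[of "Suc i"] a by simp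
        qed
        ultimately show ?thesis by simp
      qed
      then show ?thesis using A B by auto
    qed
  qed
qed

text \<open>The mirror image of the preceding lemma: reversing the order of the points and inverting
  the permutation preserves noncrossing cycles.\<close>

lemma nested_inv_descent_iff:
  assumes "nested n s"
  shows "inv s (Suc i) < inv s i \<longleftrightarrow>
      i \<le> inv s i \<and> \<not> s i \<le> i \<or> s i \<le> i \<and> \<not> Suc i \<le> inv s (Suc i)"
proof -
  note s = nested_permutes[OF assms] and n1 = nested_below_arc[OF assms]
    and n2 = nested_in_span[OF assms] and n3 = nested_block_end[OF assms]
  have inv [simp]: "s (inv s j) = j" "inv s (s j) = j" for j using s by (simp_all add: permutes_inverses)
  show ?thesis
  proof (cases "i \<le> inv s i \<and> \<not> s i \<le> i")
    case True
    then have a: "i < inv s i" by (metis inv(1) le_neq_implies_less order.refl)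
    have "inv s (Suc i) < inv s i"
    proof (cases "inv s i = Suc i")
      case T2: True
      then have "s (Suc i) = i" by (metis inv(1))
      then show ?thesis using n3[of "Suc i"] T2 by simp
    next
      case False
      then show ?thesis using n2[of "inv s i" "Suc i"] a by simp
    qed
    then show ?thesis using True by blast
  next
    case A: False
    show ?thesis
    proof (cases "s i \<le> i \<and> \<not> Suc i \<le> inv s (Suc i)")
      case True
      then have "inv s (Suc i) < i" by (metis inv(1) Suc_n_not_le_n less_antisym not_le)
      then show ?thesis using True n1[of "inv s (Suc i)" i] by simp
    next
      case B: False
      have "inv s i < inv s (Suc i)"
      proof (cases "s i \<le> i")
        case True
        then have a: "Suc i \<le> inv s (Suc i)" using B by blast
        show ?thesis
        proof (cases "inv s i \<le> i")
          case False
          then have "inv s i > i" by simp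
          then have "s (inv s i) < inv s i" by simp
          then have "s (s (inv s i)) > s (inv s i)" using n3 by blast
          then show ?thesis using True by simp
        qed (use a in simp)
      next
        case False
        then have a: "inv s i < i" using A by simp
        show ?thesis
        proof (rule ccontr)
          assume c: "\<not> inv s i < inv s (Suc i)"
          then have "inv s (Suc i) < i" using a by simp
          then have "s i < Suc i" using n1[of "inv s (Suc i)" i] by simp
          then show False using False by simp
        qed
      qed
      then show ?thesis using A B by auto
    qed
  qed
qed

lemma maj_conv_sum: "maj (Suc m) s = (\<Sum>i=1..m. if s (Suc i) < s i then i else 0)"
proof -
  have "Des (Suc m) s = {i \<in> {1..m}. s (Suc i) < s i}" by (auto simp: Des_def)
  then show ?thesis unfolding maj_def by (simp add: sum.If_cases Int_def)
qed

text \<open>Summing the contributions of the descents up to \<open>k\<close> gives \<open>scan_wt\<close> up to \<open>k\<close>, except for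
  the descent at \<open>k\<close> that is caused by \<open>k + 1\<close> closing a block opened before, which \<open>scan_wt\<close>
  charges one step later.\<close>

lemma nested_maj_imaj:
  assumes "nested (Suc m) s"
  shows "maj (Suc m) s + imaj (Suc m) s = close_wt m (extremes m s)"
proof -
  define p where "p = extremes m s"
  have s: "s permutes {1..Suc m}" using assms by (simp add: nested_def)
  have "k \<le> m \<Longrightarrow> (\<Sum>i=1..k. if s (Suc i) < s i then i else 0) + (\<Sum>i=1..k. if inv s (Suc i) < inv s i then i else 0)
      = scan_wt k p + (if s (Suc k) \<le> Suc k \<and> \<not> (k = 0 \<or> k \<in> fst p) then k else 0)" for k
  proof (induction k)
    case (Suc k)
    have x: "(k = 0 \<or> k \<in> fst p) \<longleftrightarrow> Suc k \<le> inv s (Suc k)"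
    proof (cases "k = 0")
      case True
      have "inv s (Suc 0) \<in> {1..Suc m}" using permutes_in_image[OF permutes_inv[OF s]] by simp
      then show ?thesis using True by simp
    next
      case False
      then show ?thesis using Suc.prems by (simp add: p_def extremes_def)
    qed
    have y: "Suc k \<in> snd p \<longleftrightarrow> s (Suc k) \<le> Suc k" and x': "Suc k \<in> fst p \<longleftrightarrow> Suc (Suc k) \<le> inv s (Suc (Suc k))"
      using Suc.prems by (auto simp: p_def extremes_def)
    show ?case
      using Suc nested_descent_iff[OF assms, of "Suc k"] nested_inv_descent_iff[OF assms, of "Suc k"]
      unfolding scan_wt.simps x y x' by (simp add: x split: if_splits)
  qed simp
  from this[of m] show ?thesis
  proof -
    have "s (Suc m) \<in> {1..Suc m}" using permutes_in_image[OF s] by simp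
    then show ?thesis using \<open>m \<le> m \<Longrightarrow> _\<close> unfolding imaj_def maj_conv_sum p_def[symmetric]
      by (simp add: close_wt_def)
  qed
qed

text \<open>A permutation sends the points that close a block to the points that open one, and moves none of them
  up. Hence among \<open>1, ..., i + 1\<close> there are at least as many openings as there are closings among
  \<open>1, ..., i\<close>. There is one more, because some point beyond \<open>i\<close> is sent to \<open>{1..i+1}\<close> by the
  pigeonhole principle. That extra opening makes up for the point 1, which \<open>extremes\<close> omits.\<close>

lemma extremes_in_ballot:
  assumes s: "s permutes {1..Suc m}"
  shows "extremes m s \<in> ballot m 0"
proof -
  define S where "S = {j \<in> {1..Suc m}. s j \<le> j}"
  define T where "T = {j \<in> {1..Suc m}. j \<le> inv s j}"
  define I where "I = fst (extremes m s)"
  define J where "J = snd (extremes m s)"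
  have inj: "inj s" using s by (rule permutes_inj)
  have inv [simp]: "s (inv s j) = j" "inv s (s j) = j" for j using s by (simp_all add: permutes_inverses)
  have ST: "s ` S = T"
  proof
    show "s ` S \<subseteq> T"
    proof
      fix y assume "y \<in> s ` S"
      then obtain x where x: "x \<in> {1..Suc m}" "s x \<le> x" "y = s x" unfolding S_def by blast
      have "s x \<in> {1..Suc m}" using x(1) permutes_in_image[OF s] by blast
      then show "y \<in> T" using x by (simp add: T_def)
    qed
    show "T \<subseteq> s ` S"
    proof
      fix j assume "j \<in> T"
      then have j: "j \<in> {1..Suc m}" "j \<le> inv s j" unfolding T_def by blast+
      have "inv s j \<in> {1..Suc m}" using j(1) permutes_in_image[OF permutes_inv[OF s]] by blast
      then have "inv s j \<in> S" using j by (simp add: S_def)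
      then show "j \<in> s ` S" by (metis image_eqI inv(1))
    qed
  qed
  have 1: "inv s (Suc 0) \<ge> Suc 0" and n: "s (Suc m) \<le> Suc m"
    using permutes_in_image[OF permutes_inv[OF s], of "Suc 0"] permutes_in_image[OF s, of "Suc m"] by auto
  have cT: "card (T \<inter> {1..Suc i}) = Suc (card (I \<inter> {1..i}))" if "i \<le> m" for i
  proof -
    have "T \<inter> {1..Suc i} = insert (Suc 0) (Suc ` (I \<inter> {1..i}))" (is "?A = ?B")
    proof
      show "?A \<subseteq> ?B"
      proof
        fix j assume "j \<in> ?A"
        then show "j \<in> ?B" using that 1 by (cases j) (auto simp: T_def I_def extremes_def image_iff)
      qed
      show "?B \<subseteq> ?A" using that 1 by (auto simp: T_def I_def extremes_def)
    qed
    moreover have "Suc 0 \<notin> Suc ` (I \<inter> {1..i})" by auto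
    ultimately show ?thesis by (simp add: card_image)
  qed
  have cS: "S \<inter> {1..i} = J \<inter> {1..i}" if "i \<le> m" for i
    using that by (auto simp: S_def J_def extremes_def)
  have ge: "card (J \<inter> {1..i}) \<le> card (I \<inter> {1..i})" if i: "i \<le> m" for i
  proof -
    have "\<exists>k\<ge>Suc i. k \<le> Suc m \<and> s k \<le> Suc i"
    proof (rule ccontr)
      assume no: "\<not> (\<exists>k\<ge>Suc i. k \<le> Suc m \<and> s k \<le> Suc i)"
      have "s ` {Suc i..Suc m} \<subseteq> {Suc (Suc i)..Suc m}"
      proof -
        have "s k \<in> {Suc (Suc i)..Suc m}" if "k \<in> {Suc i..Suc m}" for k
          using that no permutes_in_image[OF s, of k] by (auto simp: not_le Suc_le_eq)
        then show ?thesis by blast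
      qed
      then have "card (s ` {Suc i..Suc m}) \<le> card {Suc (Suc i)..Suc m}" by (intro card_mono) auto
      moreover have "card (s ` {Suc i..Suc m}) = card {Suc i..Suc m}"
      by (rule card_image[OF inj_on_subset[OF inj subset_UNIV]])
      ultimately show False using i by simp
    qed
    then obtain k where k: "k \<ge> Suc i" "k \<le> Suc m" "s k \<le> Suc i" by blast
    have "s ` (insert k (S \<inter> {1..i})) \<subseteq> T \<inter> {1..Suc i}"
    proof -
      have "k \<in> S" using k by (auto simp: S_def)
      moreover have "s j \<in> {1..Suc i}" if "j \<in> insert k (S \<inter> {1..i})" for j
        using that k permutes_in_image[OF s, of j] i by (auto simp: S_def)
      ultimately show ?thesis using ST by blast
    qed
    then have "card (s ` (insert k (S \<inter> {1..i}))) \<le> card (T \<inter> {1..Suc i})" by (intro card_mono) auto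
    moreover have "card (s ` (insert k (S \<inter> {1..i}))) = card (insert k (S \<inter> {1..i}))"
      by (rule card_image[OF inj_on_subset[OF inj subset_UNIV]])
    moreover have "card (insert k (S \<inter> {1..i})) = Suc (card (S \<inter> {1..i}))" using k by simp
    ultimately show ?thesis using cT[OF i] cS[OF i] by simp
  qed
  have "excess I J m = 0"
  proof -
    have "S = insert (Suc m) (J \<inter> {1..m})" using n by (auto simp: S_def J_def extremes_def le_Suc_eq)
    then have "card S = Suc (card (J \<inter> {1..m}))" by simp
    moreover have "card (s ` S) = card S"
      by (rule card_image[OF inj_on_subset[OF inj subset_UNIV]])
    moreover have "T \<inter> {1..Suc m} = T" by (auto simp: T_def)
    ultimately show ?thesis using cT[of m] ST by (simp add: excess_def)
  qed
  moreover have "\<forall>i\<le>m. 0 \<le> excess I J i" using ge by (simp add: excess_def)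
  moreover have "I \<subseteq> {1..m}" "J \<subseteq> {1..m}" by (auto simp: I_def J_def extremes_def)
  ultimately have "(I, J) \<in> ballot m 0" by (simp add: ballot_def)
  then show ?thesis by (simp add: I_def J_def)
qed

text \<open>At the last point \<open>i\<close>, not closing its block, where \<open>s\<close> and \<open>t\<close> differ, the smaller of the two images
  has to be the image of an earlier point under the other permutation, whose arc then crosses the arc of
  \<open>i\<close>. Once all such arcs agree, the same argument from the left handles the points that close
  a block.\<close>

lemma nested_extremes_inj:
  assumes s: "nested (Suc m) s" and t: "nested (Suc m) t" and eq: "extremes m s = extremes m t"
  shows "s = t"
proof -
  have ps: "s permutes {1..Suc m}" and pt: "t permutes {1..Suc m}" using s t by (auto simp: nested_def)
  have mx: "s i \<le> i \<longleftrightarrow> t i \<le> i" for i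
  proof -
    consider "i \<notin> {1..Suc m}" | "i = Suc m" | "i \<in> {1..m}" by fastforce
    then show ?thesis
    proof cases
      case 1 then show ?thesis using ps pt by (simp add: permutes_not_in)
    next
      case 2 then show ?thesis using permutes_in_image[OF ps, of i] permutes_in_image[OF pt, of i] by simp
    next
      case 3
      have "i \<in> snd (extremes m s) \<longleftrightarrow> i \<in> snd (extremes m t)" by (simp only: eq)
      then show ?thesis using 3 by (simp add: extremes_def)
    qed
  qed
  have mn: "i \<le> inv s i \<longleftrightarrow> i \<le> inv t i" for i
  proof -
    have "i = Suc (i - 1)" "i - 1 \<in> {1..m}" if "i \<in> {1..Suc m}" "i \<noteq> 1" using that by auto
    then consider "i \<notin> {1..Suc m}" | "i = 1" | j where "i = Suc j" "j \<in> {1..m}" by blast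
    then show ?thesis
    proof cases
      case 1 then show ?thesis using permutes_not_in[OF permutes_inv[OF ps]] permutes_not_in[OF permutes_inv[OF pt]] by metis
    next
      case 2 then show ?thesis using permutes_in_image[OF permutes_inv[OF ps], of i] permutes_in_image[OF permutes_inv[OF pt], of i] by simp
    next
      case 3
      have "j \<in> fst (extremes m s) \<longleftrightarrow> j \<in> fst (extremes m t)" by (simp only: eq)
      then show ?thesis using 3 by (simp add: extremes_def)
    qed
  qed
  have up: False
    if s: "nested (Suc m) s" and t: "nested (Suc m) t" and mn: "\<And>i. i \<le> inv s i \<longleftrightarrow> i \<le> inv t i"
      and agree: "\<And>j. i < j \<Longrightarrow> j < s j \<or> j < t j \<Longrightarrow> s j = t j" and i: "i < s i" "s i < t i" for s t i
  proof -
    have ps: "s permutes {1..Suc m}" and pt: "t permutes {1..Suc m}" using s t by (auto simp: nested_def)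
    have inv [simp]: "s (inv s j) = j" "inv s (s j) = j" "t (inv t j) = j" "inv t (t j) = j" for j
      using ps pt by (simp_all add: permutes_inverses)
    define j where "j = inv t (s i)"
    have tj: "t j = s i" by (simp add: j_def)
    have "inv s (s i) < s i" using i by simp
    then have js: "j < s i" unfolding j_def using mn[of "s i"] by simp
    have "j \<noteq> i" using tj i by auto
    then consider "i < j" | "j < i" by linarith
    then show False
    proof cases
      case 1
      then have "s j = s i" using agree[of j] tj js by auto
      then show False using 1 inv(2)[of j] inv(2)[of i] by simp
    next
      case 2
      then have "t i < t j" using nested_below_arc[OF t, of j i] tj i by simp
      then show False using i tj by simp
    qed
  qed
  have nonmax: "s i = t i" if "i < s i" for i
  proof (rule ccontr)
    assume neq: "s i \<noteq> t i"
    let ?D = "{i. i < s i \<and> s i \<noteq> t i}"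
    have "?D \<subseteq> {1..Suc m}"
    proof
      fix i assume i: "i \<in> ?D"
      show "i \<in> {1..Suc m}"
      proof (rule ccontr)
        assume "i \<notin> {1..Suc m}"
        then have "s i = i" using permutes_not_in[OF ps] by blast
        then show False using i by simp
      qed
    qed
    then have fin: "finite ?D" by (rule finite_subset) simp
    define k where "k = Max ?D"
    have "k \<in> ?D" using Max_in[OF fin] that neq unfolding k_def by blast
    moreover have "s j = t j" if "k < j" "j < s j \<or> j < t j" for j
    proof (rule ccontr)
      assume "s j \<noteq> t j"
      then have "j \<in> ?D" using that mx[of j] by auto
      then have "j \<le> k" unfolding k_def by (rule Max_ge[OF fin])
      then show False using that by simp
    qed
    moreover have "k < t k" using \<open>k \<in> ?D\<close> mx[of k] by auto
    ultimately have k: "k < s k" "k < t k" "s k \<noteq> t k"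
      and ag: "\<And>j. k < j \<Longrightarrow> j < s j \<or> j < t j \<Longrightarrow> s j = t j" by blast+
    have ag': "t j = s j" if "k < j" "j < t j \<or> j < s j" for j using ag[of j] that by auto
    consider "s k < t k" | "t k < s k" using k(3) by linarith
    then show False
    proof cases
      case 1
      show False by (rule up[OF s t mn ag k(1) 1])
    next
      case 2
      show False by (rule up[OF t s mn[symmetric] ag' k(2) 2])
    qed
  qed
  have down: False
    if s: "nested (Suc m) s" and t: "nested (Suc m) t" and mn: "\<And>i. i \<le> inv s i \<longleftrightarrow> i \<le> inv t i"
      and agree: "\<And>j. j < i \<Longrightarrow> s j = t j" and i: "s i < t i" "t i \<le> i" for s t i
  proof -
    have ps: "s permutes {1..Suc m}" and pt: "t permutes {1..Suc m}" using s t by (auto simp: nested_def)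
    have inv [simp]: "s (inv s j) = j" "inv s (s j) = j" "t (inv t j) = j" "inv t (t j) = j" for j
      using ps pt by (simp_all add: permutes_inverses)
    define j where "j = inv s (t i)"
    have sj: "s j = t i" by (simp add: j_def)
    have "inv t (t i) \<ge> t i" using i by simp
    then have js: "j \<ge> t i" unfolding j_def using mn[of "t i"] by simp
    have "j \<noteq> i" using sj i by auto
    then consider "j < i" | "i < j" by linarith
    then show False
    proof cases
      case 1
      then have "t j = t i" using agree[of j] sj by auto
      then show False using 1 inv(4)[of j] inv(4)[of i] by simp
    next
      case 2
      show False
      proof (cases "t i = i")
        case True
        then have "s j < s (s j)" using nested_block_end[OF s, of j] sj 2 by simp
        then show False using sj True i by simp
      next
        case False
        then have "s j < s i" using nested_in_span[OF s, of j i] sj i 2 by simp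
        then show False using sj i by simp
      qed
    qed
  qed
  have "s i = t i" for i
  proof (induction i rule: less_induct)
    case (less i)
    show ?case
    proof (rule ccontr)
      assume neq: "s i \<noteq> t i"
      then have le: "s i \<le> i" "t i \<le> i" using nonmax[of i] mx[of i] by auto
      consider "s i < t i" | "t i < s i" using neq by linarith
      then show False
      proof cases
        case 1
        show False by (rule down[OF s t mn less 1 le(2)])
      next
        case 2
        show False by (rule down[OF t s mn[symmetric] less[symmetric] 2 le(1)])
      qed
    qed
  qed
  then show ?thesis by blast
qed

section \<open>231-avoiding permutations\<close>

definition descents :: "nat \<Rightarrow> (nat \<Rightarrow> nat) \<Rightarrow> nat set \<times> nat set" where
  "descents m s = ({i \<in> {1..m}. s (Suc i) < s i}, {i \<in> {1..m}. inv s (Suc i) < inv s i})"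

lemma descents_linear_wt: "maj (Suc m) s + imaj (Suc m) s = linear_wt (descents m s)"
proof -
  have "Des (Suc m) t = {i \<in> {1..m}. t (Suc i) < t i}" for t by (auto simp: Des_def)
  then show ?thesis by (simp add: maj_def imaj_def linear_wt_def descents_def)
qed

lemma Sort_no231:
  assumes "s \<in> Sort n" "1 \<le> a" "a < b" "b < c" "c \<le> n" "s c < s a" "s a < s b"
  shows False
  using assms unfolding Sort_def by blast

text \<open>If \<open>s i < s (i+1)\<close>, any later entry below \<open>s i\<close> would complete a 231 pattern.\<close>

lemma Sort_nondescent_less:
  assumes s: "s \<in> Sort n" and i: "1 \<le> i" "\<not> s (Suc i) < s i" "i < j" "j \<le> n"
  shows "s i < s j"
proof -
  have "s permutes {1..n}" using s unfolding Sort_def by blast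
  then have inj: "inj s" by (rule permutes_inj)
  have "s i \<noteq> s (Suc i)" "s i \<noteq> s j" using i by (simp_all add: inj_eq[OF inj])
  then have "s i < s (Suc i)" using i by simp
  show ?thesis
  proof (rule ccontr)
    assume "\<not> s i < s j"
    then have "s j < s i" using \<open>s i \<noteq> s j\<close> by simp
    then have "j \<noteq> Suc i" using i by auto
    then show False using Sort_no231[OF s i(1), of "Suc i" j] i \<open>s i < s (Suc i)\<close> \<open>s j < s i\<close> by simp
  qed
qed

text \<open>So a position is a descent if and only if the value \<open>u + 1\<close> that it holds stands to the left of \<open>u\<close>.
  This makes \<open>i \<mapsto> s i - 1\<close> a bijection from the descents of \<open>s\<close> to those of its inverse.\<close>

lemma Sort_descent_iff:
  assumes s: "s \<in> Sort n" and i: "i \<in> {1..n}" "s i = Suc u"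
  shows "s (Suc i) < s i \<longleftrightarrow> inv s (Suc u) < inv s u"
proof -
  have ps: "s permutes {1..n}" using s unfolding Sort_def by blast
  have inv [simp]: "s (inv s j) = j" "inv s (s j) = j" for j using ps by (simp_all add: permutes_inverses)
  have iu: "inv s (Suc u) = i" using i by (metis inv(2))
  define p where "p = inv s u"
  have sp: "s p = u" by (simp add: p_def)
  have pn: "p \<in> {1..n}" if "u \<ge> 1"
    using permutes_in_image[OF permutes_inv[OF ps], of u] permutes_in_image[OF ps, of i] i that
    unfolding p_def by auto
  have out: "s (Suc n) = Suc n" "s 0 = 0" using ps by (simp_all add: permutes_not_in)
  show ?thesis
  proof
    assume d: "s (Suc i) < s i"
    then have "i \<noteq> n" using out permutes_in_image[OF ps, of i] i by auto
    then have "Suc i \<le> n" using i by simp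
    then have "s (Suc i) \<ge> 1" using permutes_in_image[OF ps, of "Suc i"] by simp
    then have u: "u \<ge> 1" using d i by simp
    show "inv s (Suc u) < inv s u"
    proof (rule ccontr)
      assume "\<not> ?thesis"
      then have "p < i" using iu sp i(2) unfolding p_def by (metis antisym_conv3 n_not_Suc_n)
      then have "p \<noteq> Suc i" by simp
      then have "s (Suc i) \<noteq> u" using sp by (metis inv(2))
      then have "s (Suc i) < s p" using d i sp by simp
      then show False using Sort_no231[OF s, of p i "Suc i"] \<open>p < i\<close> \<open>Suc i \<le> n\<close> pn[OF u] sp i by simp
    qed
  next
    assume a: "inv s (Suc u) < inv s u"
    then have ip: "i < p" using iu by (simp add: p_def)
    then have u: "u \<ge> 1" using out(2) sp by (metis inv(2) less_one not_less_zero not_le_imp_less)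
    show "s (Suc i) < s i"
    proof (rule ccontr)
      assume "\<not> s (Suc i) < s i"
      then have "s i < s p" using Sort_nondescent_less[OF s _ _ ip] i pn[OF u] by simp
      then show False using sp i by simp
    qed
  qed
qed

text \<open>Compare complements. The map \<open>p \<mapsto> s p - 1\<close> sends the nondescents in \<open>{1..i}\<close> together with the next one,
  \<open>N\<close>, to nondescents of the inverse in \<open>{0..i}\<close>: by \<open>Sort_nondescent_less\<close> nondescents carry increasing
  values, and the values below \<open>s N\<close> all stand before \<open>N\<close>, but not in the decreasing run between \<open>i\<close> and \<open>N\<close>,
  so that \<open>s N - 1 \<le> i\<close>. The extra element \<open>N\<close> compensates for the extra value 0.\<close>

lemma descents_in_ballot:
  assumes s: "s \<in> Sort (Suc m)"
  shows "descents m s \<in> ballot m 0"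
proof -
  have ps: "s permutes {1..Suc m}" using s unfolding Sort_def by blast
  have inv [simp]: "s (inv s j) = j" "inv s (s j) = j" for j using ps by (simp_all add: permutes_inverses)
  have inj: "inj s" using ps by (rule permutes_inj)
  define I where "I = fst (descents m s)"
  define J where "J = snd (descents m s)"
  have out: "s (Suc (Suc m)) = Suc (Suc m)" "inv s 0 = 0"
    using ps permutes_inv[OF ps] by (simp_all add: permutes_not_in)
  have I: "i \<in> I \<longleftrightarrow> s (Suc i) < s i" if "i \<in> {1..Suc m}" for i
    using that out permutes_in_image[OF ps, of i] by (auto simp: I_def descents_def le_Suc_eq)
  have J: "u \<in> J \<longleftrightarrow> inv s (Suc u) < inv s u" if "u \<le> m" for u
    using that out by (cases "u = 0") (auto simp: J_def descents_def)
  have IJ: "i \<in> I \<longleftrightarrow> s i - 1 \<in> J" if "i \<in> {1..Suc m}" for i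
  proof -
    have "s i \<in> {1..Suc m}" using permutes_in_image[OF ps, of i] that by blast
    then obtain u where u: "s i = Suc u" "u \<le> m" by (cases "s i") auto
    then show ?thesis using Sort_descent_iff[OF s that u(1)] I[OF that] J[OF u(2)] by simp
  qed
  have injm: "inj_on (\<lambda>p. s p - 1) A" if "A \<subseteq> {1..Suc m}" for A
  proof (rule inj_onI)
    fix x y assume "x \<in> A" "y \<in> A" "s x - 1 = s y - 1"
    moreover have "s x \<ge> 1" "s y \<ge> 1"
      using permutes_in_image[OF ps, of x] permutes_in_image[OF ps, of y] \<open>x \<in> A\<close> \<open>y \<in> A\<close> that by auto
    ultimately have "s x = s y" by simp
    then show "x = y" using inj by (simp add: injD)
  qed
  have ge: "card (J \<inter> {1..i}) \<le> card (I \<inter> {1..i})" if i: "i \<le> m" for i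
  proof -
    define N where "N = (LEAST k. i < k \<and> \<not> s (Suc k) < s k)"
    \<comment> \<open>\<open>m + 1\<close> counts as a nondescent, since \<open>s\<close> fixes \<open>m + 2\<close>.\<close>
    have ex: "i < Suc m \<and> \<not> s (Suc (Suc m)) < s (Suc m)" 
      using i out permutes_in_image[OF ps, of "Suc m"] by simp
    have N: "i < N" "\<not> s (Suc N) < s N" "N \<le> Suc m"
      using LeastI[of "\<lambda>k. i < k \<and> \<not> s (Suc k) < s k", OF ex] Least_le[of "\<lambda>k. i < k \<and> \<not> s (Suc k) < s k", OF ex]
      unfolding N_def by blast+
    have run: "s N < s r" if "i < r" "r < N" for r
      using \<open>r < N\<close> that(1)
    proof (induction rule: strict_inc_induct)
      case (base k)
      then show ?case using not_less_Least[of k "\<lambda>k. i < k \<and> \<not> s (Suc k) < s k"] unfolding N_def[symmetric] by auto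
    next
      case (step k)
      then have "s (Suc k) < s k" using not_less_Least[of k "\<lambda>k. i < k \<and> \<not> s (Suc k) < s k"] unfolding N_def[symmetric] by auto
      then show ?case using step by simp
    qed
    have "inv s ` {1..s N - 1} \<subseteq> {1..i}"
    proof
      fix r assume "r \<in> inv s ` {1..s N - 1}"
      then have sr: "s r < s N" "s r \<ge> 1" by auto
      have "s r \<in> {1..Suc m}" using sr permutes_in_image[OF ps, of N] N by auto
      then have r: "r \<in> {1..Suc m}" using permutes_in_image[OF ps] by blast
      have "\<not> N < r" using Sort_nondescent_less[OF s _ N(2), of r] N r sr by auto
      moreover have "r \<noteq> N" using sr by auto
      ultimately have "r < N" by simp
      then have "r \<le> i" using run[of r] sr by (meson not_le order.asym)
      then show "r \<in> {1..i}" using r by simp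
    qed
    then have "card (inv s ` {1..s N - 1}) \<le> i" using card_mono[of "{1..i}"] by fastforce
    moreover have "card (inv s ` {1..s N - 1}) = s N - 1"
      using card_image[OF inj_on_subset[OF permutes_inj[OF permutes_inv[OF ps]] subset_UNIV]] by fastforce
    ultimately have sN: "s N - 1 \<le> i" by simp
    define X where "X = insert N ({1..i} - I)"
    have Xsub: "X \<subseteq> {1..Suc m}" using N i by (auto simp: X_def)
    have "(\<lambda>p. s p - 1) ` X \<subseteq> {0..i} - J"
    proof
      fix u assume "u \<in> (\<lambda>p. s p - 1) ` X"
      then obtain p where p: "p \<in> X" "u = s p - 1" by blast
      have "p \<notin> I" using p(1) I[of N] N by (auto simp: X_def)
      moreover have pr: "p \<in> {1..Suc m}" using p Xsub by blast
      ultimately have "u \<notin> J" "\<not> s (Suc p) < s p" using IJ I p by blast+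
      moreover have "p \<le> N" using p(1) N by (auto simp: X_def)
      then have "s p \<le> s N" using Sort_nondescent_less[OF s, of p N] N pr \<open>\<not> s (Suc p) < s p\<close>
        by (cases "p = N") auto
      ultimately show "u \<in> {0..i} - J" using sN p by auto
    qed
    then have "card ((\<lambda>p. s p - 1) ` X) \<le> card ({0..i} - J)" by (intro card_mono) auto
    then have "card X \<le> card ({0..i} - J)" using card_image[OF injm[OF Xsub]] by simp
    moreover have "card X = Suc (i - card (I \<inter> {1..i}))"
      using N card_Diff_subset_Int[of "{1..i}" I] by (simp add: X_def Int_commute)
    moreover have "0 \<notin> J" by (auto simp: J_def descents_def)
    then have "{0..i} \<inter> J = J \<inter> {1..i}" by (auto simp: Suc_le_eq intro: gr0I)
    then have "card ({0..i} - J) = Suc i - card (J \<inter> {1..i})"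
      using card_Diff_subset_Int[of "{0..i}" J] by simp
    moreover have "card (J \<inter> {1..i}) \<le> i" "card (I \<inter> {1..i}) \<le> i"
      using card_mono[of "{1..i}" "J \<inter> {1..i}"] card_mono[of "{1..i}" "I \<inter> {1..i}"] by auto
    ultimately show ?thesis by linarith
  qed
  have sub: "I \<subseteq> {1..m}" "J \<subseteq> {1..m}" by (auto simp: I_def J_def descents_def)
  have "(\<lambda>p. s p - 1) ` I \<subseteq> J" using IJ sub by fastforce
  then have "card ((\<lambda>p. s p - 1) ` I) \<le> card J" using sub by (intro card_mono) (auto dest: finite_subset)
  moreover have "I \<subseteq> {1..Suc m}" using sub(1) by fastforce
  ultimately have "card I \<le> card J" using card_image[OF injm] by metis
  moreover have "I \<inter> {1..m} = I" "J \<inter> {1..m} = J" using sub by auto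
  ultimately have "excess I J m = 0" using ge[of m] by (simp add: excess_def)
  moreover have "\<forall>i\<le>m. 0 \<le> excess I J i" using ge by (simp add: excess_def)
  ultimately have "(I, J) \<in> ballot m 0" using sub by (simp add: ballot_def)
  then show ?thesis by (simp add: I_def J_def)
qed

text \<open>Consider the last position \<open>i\<close> where \<open>s\<close> and \<open>t\<close> differ, with \<open>s i < t i\<close>. If \<open>i\<close> is a descent, then in \<open>t\<close>
  the value \<open>s i\<close> stands before \<open>i\<close>, and forms a 231 pattern with the positions \<open>i\<close> and \<open>i + 1\<close>. If \<open>i\<close> is not a
  descent, then in \<open>s\<close> the value \<open>t i\<close> stands before \<open>i\<close> and, by \<open>Sort_descent_iff\<close>, also at a nondescent;
  so it is smaller than \<open>s i\<close>, a contradiction.\<close>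

lemma descents_inj:
  assumes s: "s \<in> Sort (Suc m)" and t: "t \<in> Sort (Suc m)" and eq: "descents m s = descents m t"
  shows "s = t"
proof -
  have ps: "s permutes {1..Suc m}" and pt: "t permutes {1..Suc m}" using s t unfolding Sort_def by auto
  have des: "s (Suc i) < s i \<longleftrightarrow> t (Suc i) < t i" if "i \<in> {1..Suc m}" for i
  proof (cases "i = Suc m")
    case True
    then show ?thesis using permutes_in_image[OF ps, of i] permutes_in_image[OF pt, of i]
        permutes_not_in[OF ps, of "Suc i"] permutes_not_in[OF pt, of "Suc i"] by simp
  next
    case False
    have "i \<in> fst (descents m s) \<longleftrightarrow> i \<in> fst (descents m t)" by (simp only: eq)
    then show ?thesis using False that by (simp add: descents_def)
  qed
  have ides: "inv s (Suc u) < inv s u \<longleftrightarrow> inv t (Suc u) < inv t u" if "u \<le> m" for u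
  proof (cases "u = 0")
    case True
    then show ?thesis using permutes_not_in[OF permutes_inv[OF ps], of 0] permutes_not_in[OF permutes_inv[OF pt], of 0] by simp
  next
    case False
    have "u \<in> snd (descents m s) \<longleftrightarrow> u \<in> snd (descents m t)" by (simp only: eq)
    then show ?thesis using False that by (simp add: descents_def)
  qed
  have up: False
    if s: "s \<in> Sort (Suc m)" and t: "t \<in> Sort (Suc m)" and i: "i \<in> {1..Suc m}"
      and des: "\<And>i. i \<in> {1..Suc m} \<Longrightarrow> s (Suc i) < s i \<longleftrightarrow> t (Suc i) < t i"
      and ides: "\<And>u. u \<le> m \<Longrightarrow> inv s (Suc u) < inv s u \<longleftrightarrow> inv t (Suc u) < inv t u"
      and agree: "\<And>j. i < j \<Longrightarrow> s j = t j" and lt: "s i < t i" for s t i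
  proof -
    have ps: "s permutes {1..Suc m}" and pt: "t permutes {1..Suc m}" using s t unfolding Sort_def by auto
    have inv [simp]: "s (inv s j) = j" "inv s (s j) = j" "t (inv t j) = j" "inv t (t j) = j" for j
      using ps pt by (simp_all add: permutes_inverses)
    show False
    proof (cases "s (Suc i) < s i")
      case True
      define p where "p = inv t (s i)"
      have tp: "t p = s i" by (simp add: p_def)
      have p: "p \<in> {1..Suc m}" using tp permutes_in_image[OF pt, of p] permutes_in_image[OF ps, of i] i by simp
      have "p \<noteq> i" using tp lt by auto
      moreover have "\<not> i < p" using agree[of p] tp by (metis inv(2) less_irrefl)
      ultimately have "p < i" by simp
      moreover have "i \<noteq> Suc m"
        using True permutes_in_image[OF ps, of i] permutes_not_in[OF ps, of "Suc i"] i by auto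
      ultimately show False
        using Sort_no231[OF t, of p i "Suc i"] agree[of "Suc i"] True p i tp lt by auto
    next
      case False
      obtain u where u: "t i = Suc u" "u \<le> m" using permutes_in_image[OF pt, of i] i by (cases "t i") auto
      define p where "p = inv s (t i)"
      have sp: "s p = Suc u" by (simp add: p_def u)
      have p: "p \<in> {1..Suc m}" using sp u permutes_in_image[OF ps, of p] by simp
      have "p \<noteq> i" using sp u lt by auto
      moreover have "\<not> i < p" using agree[of p] sp u by (metis inv(4) less_irrefl)
      ultimately have "p < i" by simp
      have "\<not> s (Suc p) < s p"
        using Sort_descent_iff[OF s p sp] Sort_descent_iff[OF t i u(1)] des[OF i] ides[OF u(2)] False by blast
      then have "s p < s i" using Sort_nondescent_less[OF s _ _ \<open>p < i\<close>] p i by simp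
      then show False using sp u lt by simp
    qed
  qed
  show ?thesis
  proof (rule ccontr)
    assume "s \<noteq> t"
    let ?D = "{i. s i \<noteq> t i}"
    have sub: "?D \<subseteq> {1..Suc m}"
    proof
      fix i assume i: "i \<in> ?D"
      show "i \<in> {1..Suc m}"
      proof (rule ccontr)
        assume "i \<notin> {1..Suc m}"
        then have "s i = i" "t i = i" using permutes_not_in[OF ps] permutes_not_in[OF pt] by blast+
        then show False using i by simp
      qed
    qed
    then have fin: "finite ?D" by (rule finite_subset) simp
    have "?D \<noteq> {}" using \<open>s \<noteq> t\<close> by auto
    define k where "k = Max ?D"
    have k: "k \<in> ?D" using Max_in[OF fin \<open>?D \<noteq> {}\<close>] by (simp add: k_def)
    then have kn: "k \<in> {1..Suc m}" using sub by blast
    have ag: "s j = t j" if "k < j" for j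
      using Max_ge[OF fin, of j] that unfolding k_def[symmetric] by fastforce
    consider "s k < t k" | "t k < s k" using k by fastforce
    then show False
    proof cases
      case 1
      show False by (rule up[OF s t kn des ides ag 1])
    next
      case 2
      show False by (rule up[OF t s kn des[symmetric] ides[symmetric] ag[symmetric] 2])
    qed
  qed
qed

section \<open>Permutations from partitions\<close>

text \<open>The second condition translates membership in \<open>extremes\<close> into statements about blocks.\<close>

lemma NC_of_partition:
  assumes P: "partition_on {1..n} P" "noncrossing P"
  obtains s where "s \<in> NC n"
    "\<And>B i. B \<in> P \<Longrightarrow> i \<in> B \<Longrightarrow> (s i \<le> i \<longleftrightarrow> (\<forall>j\<in>B. j \<le> i)) \<and> (i \<le> inv s i \<longleftrightarrow> (\<forall>j\<in>B. i \<le> j))"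
proof -
  define blk where "blk i = (THE B. B \<in> P \<and> i \<in> B)" for i
  define s where "s i = (if i \<in> {1..n} then cycle_of_list (sorted_list_of_set (blk i)) i else i)" for i
  have un: "\<Union>P = {1..n}" and disj: "\<And>B C. B \<in> P \<Longrightarrow> C \<in> P \<Longrightarrow> B \<noteq> C \<Longrightarrow> B \<inter> C = {}"
    using P(1) unfolding partition_on_def disjoint_def by blast+
  have blk: "blk i = B" if "B \<in> P" "i \<in> B" for B i
    unfolding blk_def
  proof (rule the_equality)
    show "C = B" if "C \<in> P \<and> i \<in> C" for C using disj[of C B] that \<open>B \<in> P\<close> \<open>i \<in> B\<close> by blast
  qed (use that in blast)
  have fin: "finite B" if "B \<in> P" for B
  proof (rule finite_subset)
    show "B \<subseteq> {1..n}" using un that by blast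
  qed simp
  have cyc: "s i = cycle_of_list (sorted_list_of_set B) i" if "B \<in> P" "i \<in> B" for B i
  proof -
    have "i \<in> {1..n}" using un that by blast
    then show ?thesis using blk[OF that] by (simp add: s_def)
  qed
  have onB: "s ` B = B" if B: "B \<in> P" for B
  proof -
    have "s ` B = cycle_of_list (sorted_list_of_set B) ` set (sorted_list_of_set B)"
      using cyc[OF B] fin[OF B] by simp
    also have "\<dots> = set (sorted_list_of_set B)" by (rule cycle_is_surj) simp
    finally show ?thesis using fin[OF B] by simp
  qed
  have "s ` {1..n} = {1..n}"
  proof -
    have "s ` (\<Union>P) = (\<Union>B\<in>P. s ` B)" by blast
    also have "\<dots> = \<Union>P" using onB by simp
    finally show ?thesis unfolding un .
  qed
  then have "bij_betw s {1..n} {1..n}"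
    unfolding bij_betw_def using eq_card_imp_inj_on[of "{1..n}" s] by simp
  then have ps: "s permutes {1..n}" by (rule bij_imp_permutes) (unfold s_def, rule if_not_P)
  have inv: "s (inv s j) = j" for j using ps by (simp add: permutes_inverses)
  have NC: "s \<in> NC n"
    unfolding NC_def using ps P cyc by blast
  have ext: "(s i \<le> i \<longleftrightarrow> (\<forall>j\<in>B. j \<le> i)) \<and> (i \<le> inv s i \<longleftrightarrow> (\<forall>j\<in>B. i \<le> j))" if B: "B \<in> P" "i \<in> B" for B i
  proof -
    note c = cycle_of_sorted_list_of_set[OF fin[OF B(1)]]
    have iB: "inv s i \<in> B"
    proof -
      obtain k where "k \<in> B" "i = s k" using onB[OF B(1)] B(2) by blast
      then show ?thesis using permutes_inj[OF ps] by simp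
    qed
    have "s i \<le> i" if "\<forall>j\<in>B. j \<le> i"
      using c(1)[OF B(2)] cyc[OF B] that by simp
    moreover have "j \<le> i" if "s i \<le> i" "j \<in> B" for j
      using c(2)[OF B(2) that(2)] cyc[OF B] that(1) by fastforce
    moreover have "i \<le> inv s i" if "\<forall>j\<in>B. i \<le> j" using that iB by blast
    moreover have "i \<le> j" if "i \<le> inv s i" "j \<in> B" for j
    proof (cases "\<exists>k\<in>B. inv s i < k")
      case True
      then obtain k where "k \<in> B" "inv s i < k" by blast
      then have "inv s i < s (inv s i)" using c(2)[OF iB] cyc[OF B(1) iB] by simp
      then show ?thesis using that(1) inv[of i] by simp
    next
      case False
      then have "\<And>k. k \<in> B \<Longrightarrow> k \<le> inv s i" by (simp add: not_less)
      then have "s (inv s i) \<le> j" using c(3)[OF iB _ that(2)] cyc[OF B(1) iB] by simp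
      then show ?thesis using inv[of i] by simp
    qed
    ultimately show ?thesis by blast
  qed
  show ?thesis using that NC ext by blast
qed

text \<open>Here \<open>key v\<close> is to be thought of as the least element of the block of \<open>v\<close>. The permutation \<open>r\<close> lists
  the values by increasing key, and decreasingly among equal keys. In a 231 pattern the two larger entries
  cannot have the same key, and then both keys lie below both entries, which is a crossing. The list
  determines the keys, because \<open>key v\<close> is the least entry from \<open>v\<close> onwards.\<close>

lemma Sort_of_key:
  fixes key :: "nat \<Rightarrow> nat"
  assumes key: "\<And>v. v \<in> {1..n} \<Longrightarrow> key v \<in> {1..n} \<and> key v \<le> v \<and> key (key v) = key v"
    and nc: "\<And>x y. x \<in> {1..n} \<Longrightarrow> y \<in> {1..n} \<Longrightarrow> key x < key y \<Longrightarrow> key y < x \<Longrightarrow> \<not> x < y"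
  obtains r where "r \<in> Sort n" "\<And>v. v \<in> {1..n} \<Longrightarrow> key v = Min {w \<in> {1..n}. inv r v \<le> inv r w}"
proof -
  define before where "before w v \<longleftrightarrow> key w < key v \<or> key w = key v \<and> v < w" for w v
  define pos where "pos v = (if v \<in> {1..n} then card {w \<in> {1..n}. w = v \<or> before w v} else v)" for v
  have less: "pos w < pos v" if "w \<in> {1..n}" "v \<in> {1..n}" "before w v" for w v
  proof -
    have "v \<notin> {u \<in> {1..n}. u = w \<or> before u w}" using that(3) by (auto simp: before_def)
    moreover have "v \<in> {u \<in> {1..n}. u = v \<or> before u v}" using that(2) by blast
    moreover have "{u \<in> {1..n}. u = w \<or> before u w} \<subseteq> {u \<in> {1..n}. u = v \<or> before u v}"
      using that(3) by (auto simp: before_def)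
    ultimately have "{u \<in> {1..n}. u = w \<or> before u w} \<subset> {u \<in> {1..n}. u = v \<or> before u v}" by blast
    then have "card {u \<in> {1..n}. u = w \<or> before u w} < card {u \<in> {1..n}. u = v \<or> before u v}"
      by (intro psubset_card_mono) simp_all
    then show ?thesis unfolding pos_def using that(1,2) by simp
  qed
  have less_iff: "pos w < pos v \<longleftrightarrow> before w v" if "w \<in> {1..n}" "v \<in> {1..n}" for w v
  proof -
    have "before w v \<or> w = v \<or> before v w" unfolding before_def by (meson linorder_neqE_nat)
    then show ?thesis using less[OF that] less[OF that(2,1)] by (auto simp: before_def)
  qed
  have "inj_on pos {1..n}"
  proof (rule inj_onI)
    fix w v assume "w \<in> {1..n}" "v \<in> {1..n}" "pos w = pos v"
    then have "\<not> before w v" "\<not> before v w" using less by fastforce+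
    then show "w = v" unfolding before_def by (meson linorder_neqE_nat)
  qed
  moreover have "pos ` {1..n} \<subseteq> {1..n}"
  proof
    fix p assume "p \<in> pos ` {1..n}"
    then obtain v where v: "v \<in> {1..n}" "p = pos v" by blast
    have "card {w \<in> {1..n}. w = v \<or> before w v} \<le> card {1..n}" by (intro card_mono) auto
    moreover have "0 < card {w \<in> {1..n}. w = v \<or> before w v}" using v(1) by (subst card_gt_0_iff) auto
    moreover have "p = card {w \<in> {1..n}. w = v \<or> before w v}" unfolding v(2) pos_def using v(1) by (rule if_P)
    ultimately show "p \<in> {1..n}" by (simp only: atLeastAtMost_iff card_atLeastAtMost) linarith
  qed
  ultimately have "bij_betw pos {1..n} {1..n}"
    unfolding bij_betw_def using endo_inj_surj[of "{1..n}" pos] by simp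
  then have pp: "pos permutes {1..n}" by (rule bij_imp_permutes) (unfold pos_def, rule if_not_P)
  define r where "r = inv pos"
  have pr: "r permutes {1..n}" unfolding r_def by (rule permutes_inv[OF pp])
  have invr: "inv r = pos" unfolding r_def by (rule permutes_inv_inv[OF pp])
  have posr: "pos (r a) = a" for a unfolding r_def using pp by (simp add: permutes_inverses)
  have "r \<in> Sort n"
  proof -
    have False if "1 \<le> a" "a < b" "b < c" "c \<le> n" "r c < r a" "r a < r b" for a b c
    proof -
      have i: "r a \<in> {1..n}" "r b \<in> {1..n}" "r c \<in> {1..n}"
      proof -
        have "a \<in> {1..n}" "b \<in> {1..n}" "c \<in> {1..n}" using that by auto
        then show "r a \<in> {1..n}" "r b \<in> {1..n}" "r c \<in> {1..n}" using permutes_in_image[OF pr] by blast+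
      qed
      have ab: "before (r a) (r b)" using less_iff[OF i(1,2)] posr that by simp
      have bc: "before (r b) (r c)" using less_iff[OF i(2,3)] posr that by simp
      have "key (r a) < key (r b)" using ab that by (auto simp: before_def)
      moreover have "key (r b) \<le> key (r c)" using bc by (auto simp: before_def)
      then have "key (r b) < r a" using key[OF i(3)] that by linarith
      ultimately show False using nc[OF i(1,2)] that by blast
    qed
    then show ?thesis unfolding Sort_def using pr by blast
  qed
  moreover have "key v = Min {w \<in> {1..n}. inv r v \<le> inv r w}" if v: "v \<in> {1..n}" for v
  proof (rule Min_eqI[symmetric])
    show "finite {w \<in> {1..n}. inv r v \<le> inv r w}" by simp
    show "key v \<le> y" if "y \<in> {w \<in> {1..n}. inv r v \<le> inv r w}" for y
    proof -
      have y: "y \<in> {1..n}" "\<not> pos y < pos v" using that by (auto simp: invr)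
      then have "\<not> before y v" using less v by blast
      then have "key v \<le> key y" by (auto simp: before_def)
      then show ?thesis using key[OF y(1)] by linarith
    qed
    have "\<not> before (key v) v" using key[OF v] by (auto simp: before_def)
    then have "pos v \<le> pos (key v)" using less_iff[of "key v" v] key[OF v] v by (simp add: not_less)
    then show "key v \<in> {w \<in> {1..n}. inv r v \<le> inv r w}" using key[OF v] by (simp add: invr)
  qed
  ultimately show ?thesis using that by blast
qed

section \<open>The noncrossing partition of a ballot pair\<close>

text \<open>Each position of the path is split into two half steps, and the point \<open>k\<close> sits at the height
  \<open>excess I J (k - 1)\<close>. Between the points \<open>k - 1\<close> and \<open>k\<close> the path first falls if \<open>k - 1 \<in> J\<close> and then rises if
  \<open>k - 1 \<in> I\<close>; \<open>level_low\<close> is the height in the middle. The value \<open>-1\<close> at the beginning lies below all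
  points.\<close>

definition level_low :: "nat set \<Rightarrow> nat set \<Rightarrow> nat \<Rightarrow> int" where
  "level_low I J k = (if k \<le> 1 then -1 else excess I J (k - 2) - of_bool (k - 1 \<in> J))"

text \<open>Two points belong together if the horizontal line through one of them, drawn below the path, reaches
  the other. The classes of this relation are the blocks of the partition of a ballot pair.\<close>

definition linked :: "nat set \<Rightarrow> nat set \<Rightarrow> nat \<Rightarrow> nat \<Rightarrow> bool" where
  "linked I J i j \<longleftrightarrow> excess I J (i - 1) = excess I J (j - 1) \<and>
     (\<forall>k. min i j < k \<and> k \<le> max i j \<longrightarrow> excess I J (i - 1) \<le> level_low I J k)"

lemma linkedD:
  assumes "linked I J i j"
  shows "excess I J (i - 1) = excess I J (j - 1)"
    and "i < k \<Longrightarrow> k \<le> j \<Longrightarrow> excess I J (i - 1) \<le> level_low I J k"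
proof -
  show "excess I J (i - 1) = excess I J (j - 1)" using assms unfolding linked_def by blast
  have low: "\<forall>k. min i j < k \<and> k \<le> max i j \<longrightarrow> excess I J (i - 1) \<le> level_low I J k"
    using assms unfolding linked_def by blast
  assume "i < k" "k \<le> j"
  then have "min i j < k" "k \<le> max i j" by linarith+
  then show "excess I J (i - 1) \<le> level_low I J k" using low by blast
qed

lemma linked_sym: "linked I J i j \<Longrightarrow> linked I J j i"
  unfolding linked_def by (metis max.commute min.commute)

lemma linked_trans:
  assumes "linked I J i j" "linked I J j k"
  shows "linked I J i k"
  unfolding linked_def
proof (intro conjI allI impI)
  show "excess I J (i - 1) = excess I J (k - 1)" using assms by (simp add: linked_def)
  fix l assume "min i k < l \<and> l \<le> max i k"
  then have "min i j < l \<and> l \<le> max i j \<or> min j k < l \<and> l \<le> max j k" by linarith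
  then show "excess I J (i - 1) \<le> level_low I J l" using assms unfolding linked_def by metis
qed

lemma linked_refl: "linked I J i i"
  by (simp add: linked_def)

lemma level_low_le: "0 \<le> excess I J (k - 1) \<Longrightarrow> level_low I J k \<le> excess I J (k - 1)"
  using excess_Suc[of I J "k - 2"] by (auto simp: level_low_def Suc_diff_Suc numeral_2_eq_2)

text \<open>The path stays above the height of \<open>a\<close> as far as \<open>c\<close>, hence \<open>b\<close> is not lower than \<open>a\<close>. In the same way \<open>c\<close>
  is not lower than \<open>b\<close>. As \<open>a\<close> and \<open>c\<close> have the same height, so has \<open>b\<close>.\<close>

lemma linked_noncrossing:
  assumes ac: "linked I J a c" and bd: "linked I J b d" and "a < b" "b < c" "c < d"
    and nn: "0 \<le> excess I J (b - 1)" "0 \<le> excess I J (c - 1)"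
  shows "linked I J a b"
proof -
  have lo: "excess I J (a - 1) \<le> level_low I J k" if "a < k" "k \<le> c" for k
    by (rule linkedD(2)[OF ac that])
  have "excess I J (a - 1) \<le> excess I J (b - 1)"
    using lo[of b] level_low_le[OF nn(1)] assms(3,4) by simp
  moreover have "excess I J (b - 1) \<le> level_low I J c"
    using linkedD(2)[OF bd assms(4)] assms(5) by simp
  then have "excess I J (b - 1) \<le> excess I J (c - 1)" using level_low_le[OF nn(2)] by simp
  ultimately have "excess I J (a - 1) = excess I J (b - 1)" using linkedD(1)[OF ac] by simp
  then show ?thesis using lo assms(3,4) by (simp add: linked_def)
qed

text \<open>If the path falls right after \<open>i\<close>, then it dips below \<open>i\<close> at once. Otherwise the first later point that is
  not higher than \<open>i\<close> is linked to \<open>i\<close>; it exists because the path ends at height 0.\<close>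

lemma linked_max:
  assumes p: "(I, J) \<in> ballot m 0" and i: "i \<in> {1..Suc m}"
  shows "(\<forall>j\<in>{1..Suc m}. linked I J i j \<longrightarrow> j \<le> i) \<longleftrightarrow> i = Suc m \<or> i \<in> J"
proof -
  have ex: "0 \<le> excess I J k" if "k \<le> m" for k using p that by (auto simp: ballot_def)
  have em: "excess I J m = 0" using p by (simp add: ballot_def)
  have low: "level_low I J (Suc k) = excess I J (k - 1) - of_bool (k \<in> J)" if "k \<ge> 1" for k
    using that by (simp add: level_low_def)
  show ?thesis
  proof (cases "i = Suc m \<or> i \<in> J")
    case True
    have "j \<le> i" if "j \<in> {1..Suc m}" "linked I J i j" for j
    proof (rule ccontr)
      assume "\<not> j \<le> i"
      then have "excess I J (i - 1) \<le> level_low I J (Suc i)" using linkedD(2)[OF that(2), of "Suc i"] by simp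
      moreover have "i \<in> J" using True \<open>\<not> j \<le> i\<close> that(1) by auto
      ultimately show False using low[of i] i by simp
    qed
    then show ?thesis using True by blast
  next
    case False
    define Q where "Q k \<longleftrightarrow> i < k \<and> excess I J (k - 1) \<le> excess I J (i - 1)" for k
    define j where "j = (LEAST k. Q k)"
    have "Q (Suc m)" using False i em ex[of "i - 1"] by (auto simp: Q_def)
    then have j: "Q j" "j \<le> Suc m" unfolding j_def by (rule LeastI, rule Least_le)
    have between: "excess I J (i - 1) < excess I J (k - 1)" if "i < k" "k < j" for k
    proof -
      have "\<not> Q k" using not_less_Least[of k Q] that(2) unfolding j_def by blast
      then show ?thesis using that(1) by (simp add: Q_def)
    qed
    have ij: "i < j" using j by (simp add: Q_def)
    have lows: "excess I J (i - 1) \<le> level_low I J k" if "i < k" "k \<le> j" for k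
    proof (cases "k = Suc i")
      case True
      then show ?thesis using low[of i] False i by simp
    next
      case F: False
      then have "excess I J (i - 1) < excess I J (k - 1 - 1)" using between[of "k - 1"] that by simp
      moreover have "level_low I J k \<ge> excess I J (k - 1 - 1) - 1"
      proof -
        have "1 \<le> k - 1" "Suc (k - 1) = k" using that i F by auto
        then show ?thesis using low[of "k - 1"] by simp
      qed
      ultimately show ?thesis by simp
    qed
    have "excess I J (i - 1) \<le> excess I J (j - 1)"
    proof -
      have "0 \<le> excess I J (j - 1)" using j(2) by (intro ex) linarith
      then show ?thesis using lows[of j] ij level_low_le[of I J j] by simp
    qed
    then have "excess I J (i - 1) = excess I J (j - 1)" using j(1) by (simp add: Q_def)
    then have "linked I J i j" using lows ij by (simp add: linked_def)
    then show ?thesis using False ij j(2) i by fastforce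
  qed
qed

text \<open>The mirror image of \<open>linked_max\<close>: look for the last earlier point that is not higher than \<open>i\<close>.\<close>

lemma linked_min:
  assumes p: "(I, J) \<in> ballot m 0" and i: "i \<in> {1..Suc m}"
  shows "(\<forall>j\<in>{1..Suc m}. linked I J i j \<longrightarrow> i \<le> j) \<longleftrightarrow> i = 1 \<or> i - 1 \<in> I"
proof -
  have ex: "0 \<le> excess I J k" if "k \<le> m" for k using p that by (auto simp: ballot_def)
  have low: "level_low I J (Suc k) = excess I J (k - 1) - of_bool (k \<in> J)" if "k \<ge> 1" for k
    using that by (simp add: level_low_def)
  have step: "excess I J k = excess I J (k - 1) + of_bool (k \<in> I) - of_bool (k \<in> J)" if "k \<ge> 1" for k
    using excess_Suc[of I J "k - 1"] that by simp
  show ?thesis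
  proof (cases "i = 1 \<or> i - 1 \<in> I")
    case True
    have "level_low I J i < excess I J (i - 1)"
    proof (cases "i = 1")
      case True then show ?thesis by (simp add: level_low_def)
    next
      case False
      then have "1 \<le> i - 1" "Suc (i - 1) = i" "i - 1 \<in> I" using True i by auto
      then show ?thesis using low[of "i - 1"] step[of "i - 1"] by simp
    qed
    then have "i \<le> j" if "linked I J i j" for j
      using that unfolding linked_def by (metis max.cobounded1 min_less_iff_disj not_le)
    then show ?thesis using True by blast
  next
    case False
    define Q where "Q k \<longleftrightarrow> 1 \<le> k \<and> k < i \<and> excess I J (k - 1) \<le> excess I J (i - 1)" for k
    have fin: "finite (Collect Q)" by (rule finite_subset[of _ "{..i}"]) (auto simp: Q_def)
    have "Q 1" using False i ex[of "i - 1"] by (auto simp: Q_def)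
    define j where "j = Max (Collect Q)"
    have j: "Q j" using Max_in[OF fin] \<open>Q 1\<close> unfolding j_def by blast
    have between: "excess I J (i - 1) < excess I J (k - 1)" if "j < k" "k < i" for k
    proof (rule ccontr)
      assume "\<not> ?thesis"
      then have "Q k" using that j by (simp add: Q_def)
      then have "k \<le> j" unfolding j_def using fin by (simp add: Max_ge)
      then show False using that by simp
    qed
    have lowi: "level_low I J i = excess I J (i - 1)"
    proof -
      have "1 \<le> i - 1" "Suc (i - 1) = i" "i - 1 \<notin> I" using False i by auto
      then show ?thesis using low[of "i - 1"] step[of "i - 1"] by simp
    qed
    have ge: "excess I J (i - 1) \<le> excess I J (j - 1)"
    proof (cases "Suc j = i")
      case True
      then show ?thesis using lowi low[of j] j by (simp add: Q_def)
    next
      case F: False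
      then have "excess I J (i - 1) < excess I J j" using between[of "Suc j"] j by (simp add: Q_def)
      then show ?thesis using step[of j] j by (cases "j \<in> I"; cases "j \<in> J") (simp_all add: Q_def)
    qed
    then have eq: "excess I J (i - 1) = excess I J (j - 1)" using j by (simp add: Q_def)
    have lows: "excess I J (i - 1) \<le> level_low I J k" if "j < k" "k \<le> i" for k
    proof (cases "k = i")
      case True
      then show ?thesis using lowi by simp
    next
      case F: False
      then have k: "k < i" "k - 1 \<ge> 1" using that j by (auto simp: Q_def)
      have "excess I J (i - 1) < excess I J (k - 1)" using between that k by simp
      moreover have "excess I J (k - 1) \<le> level_low I J k + 1"
        using low[of "k - 1"] step[of "k - 1"] k by simp
      ultimately show ?thesis by simp
    qed
    have "linked I J i j" using lows eq j by (simp add: linked_def Q_def)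
    then show ?thesis using False j i by (auto simp: Q_def)
  qed
qed

lemma extremes_surj:
  assumes p: "p \<in> ballot m 0"
  shows "\<exists>s\<in>NC (Suc m). extremes m s = p"
proof -
  obtain I J where IJ: "p = (I, J)" by (cases p)
  note p' = p[unfolded IJ]
  have ex: "0 \<le> excess I J k" if "k \<le> m" for k using p' that by (auto simp: ballot_def)
  define blk where "blk i = {j \<in> {1..Suc m}. linked I J i j}" for i
  define P where "P = blk ` {1..Suc m}"
  have blk: "blk i = B" if "B \<in> P" "i \<in> B" for B i
    using that unfolding P_def blk_def by (auto intro: linked_sym linked_trans)
  have part: "partition_on {1..Suc m} P"
  proof (rule partition_onI)
    show "\<Union>P = {1..Suc m}" unfolding P_def blk_def using linked_refl by blast
    show "disjnt B C" if "B \<in> P" "C \<in> P" "B \<noteq> C" for B C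
      using blk that unfolding disjnt_def by blast
    show "{} \<notin> P" unfolding P_def blk_def using linked_refl by blast
  qed
  have "noncrossing P"
    unfolding noncrossing_def
  proof (intro notI, elim bexE conjE exE)
    fix B C a b c d assume B: "B \<in> P" "a \<in> B" "c \<in> B" and C: "C \<in> P" "b \<in> C" "d \<in> C"
      and lt: "a < b" "b < c" "c < d" and "B \<noteq> C"
    have "c \<in> blk a" "d \<in> blk b" using blk[OF B(1,2)] blk[OF C(1,2)] B C by auto
    then have "linked I J a c" "linked I J b d" "d \<le> Suc m" by (auto simp: blk_def)
    moreover have "0 \<le> excess I J (b - 1)" "0 \<le> excess I J (c - 1)" using ex \<open>d \<le> Suc m\<close> lt by auto
    ultimately have "linked I J a b" using linked_noncrossing lt by blast
    moreover have "b \<in> blk b" using blk[OF C(1,2)] C by simp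
    ultimately have "b \<in> blk a" by (simp add: blk_def)
    then show False using blk[OF B(1,2)] blk[OF B(1)] blk[OF C(1,2)] \<open>B \<noteq> C\<close> by blast
  qed
  then obtain s where s: "s \<in> NC (Suc m)"
    and ext: "\<And>B i. B \<in> P \<Longrightarrow> i \<in> B \<Longrightarrow> (s i \<le> i \<longleftrightarrow> (\<forall>j\<in>B. j \<le> i)) \<and> (i \<le> inv s i \<longleftrightarrow> (\<forall>j\<in>B. i \<le> j))"
    using NC_of_partition[OF part] by blast
  have mx: "s i \<le> i \<longleftrightarrow> i = Suc m \<or> i \<in> J" and mn: "i \<le> inv s i \<longleftrightarrow> i = 1 \<or> i - 1 \<in> I" if "i \<in> {1..Suc m}" for i
  proof -
    have B: "blk i \<in> P" "i \<in> blk i" using that by (auto simp: P_def blk_def linked_refl)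
    have all: "(\<forall>j\<in>blk i. Q j) \<longleftrightarrow> (\<forall>j\<in>{1..Suc m}. linked I J i j \<longrightarrow> Q j)" for Q
      unfolding blk_def by blast
    show "s i \<le> i \<longleftrightarrow> i = Suc m \<or> i \<in> J"
      using ext[OF B] linked_max[OF p' that] unfolding all by blast
    show "i \<le> inv s i \<longleftrightarrow> i = 1 \<or> i - 1 \<in> I"
      using ext[OF B] linked_min[OF p' that] unfolding all by blast
  qed
  have "I \<subseteq> {1..m}" "J \<subseteq> {1..m}" using p' by (auto simp: ballot_def)
  then have "extremes m s = p"
  proof -
    have "i \<in> J \<longleftrightarrow> s i \<le> i" "i \<in> I \<longleftrightarrow> Suc i \<le> inv s (Suc i)" if "i \<in> {1..m}" for i
      using mx[of i] mn[of "Suc i"] that by auto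
    then have "{i \<in> {1..m}. Suc i \<le> inv s (Suc i)} = I" "{i \<in> {1..m}. s i \<le> i} = J"
      using \<open>I \<subseteq> {1..m}\<close> \<open>J \<subseteq> {1..m}\<close> by blast+
    then show ?thesis by (simp only: extremes_def IJ)
  qed
  then show ?thesis using s by blast
qed

text \<open>The permutation built from a ballot pair by \<open>Sort_of_key\<close> determines the least elements of the blocks,
  hence the relation \<open>linked\<close>, and then the pair through the extreme points of the blocks.\<close>

lemma card_ballot_le_Sort: "card (ballot m 0) \<le> card (Sort (Suc m))"
proof -
  define key where "key p v = Min {u \<in> {1..Suc m}. linked (fst p) (snd p) v u}" for p v
  have key: "key p v \<in> {1..Suc m}" "linked (fst p) (snd p) v (key p v)"
    "\<And>u. u \<in> {1..Suc m} \<Longrightarrow> linked (fst p) (snd p) v u \<Longrightarrow> key p v \<le> u" if "v \<in> {1..Suc m}" for p v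
  proof -
    let ?S = "{u \<in> {1..Suc m}. linked (fst p) (snd p) v u}"
    have fin: "finite ?S" by simp
    have "v \<in> ?S" using that linked_refl by blast
    then have "key p v \<in> ?S" unfolding key_def using Min_in[OF fin] by blast
    then show "key p v \<in> {1..Suc m}" "linked (fst p) (snd p) v (key p v)" by blast+
    show "key p v \<le> u" if "u \<in> {1..Suc m}" "linked (fst p) (snd p) v u" for u
      unfolding key_def using Min_le[OF fin] that by blast
  qed
  have key_eq: "key p v = key p w \<longleftrightarrow> linked (fst p) (snd p) v w" if "v \<in> {1..Suc m}" "w \<in> {1..Suc m}" for p v w
  proof
    assume "key p v = key p w"
    then show "linked (fst p) (snd p) v w" using key(2)[OF that(1), where p = p] key(2)[OF that(2), where p = p]
      by (metis linked_sym linked_trans)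
  next
    assume "linked (fst p) (snd p) v w"
    then have "{u \<in> {1..Suc m}. linked (fst p) (snd p) v u} = {u \<in> {1..Suc m}. linked (fst p) (snd p) w u}"
      using linked_sym linked_trans by blast
    then show "key p v = key p w" by (simp add: key_def)
  qed
  have "\<exists>r\<in>Sort (Suc m). \<forall>v\<in>{1..Suc m}. key p v = Min {w \<in> {1..Suc m}. inv r v \<le> inv r w}"
    if p: "p \<in> ballot m 0" for p
  proof (rule Sort_of_key[where n = "Suc m" and key = "key p"])
    fix v assume v: "v \<in> {1..Suc m}"
    show "key p v \<in> {1..Suc m} \<and> key p v \<le> v \<and> key p (key p v) = key p v"
    proof -
      have 1: "key p v \<in> {1..Suc m}" and 2: "linked (fst p) (snd p) v (key p v)" by (rule key[OF v])+
      have "key p v = key p (key p v)" using key_eq[OF v 1] 2 by blast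
      moreover have "key p v \<le> v" by (rule key(3)[OF v v linked_refl])
      ultimately show ?thesis using 1 by simp
    qed
  next
    fix x y assume x: "x \<in> {1..Suc m}" and y: "y \<in> {1..Suc m}" and lt: "key p x < key p y" "key p y < x"
    show "\<not> x < y"
    proof
      assume "x < y"
      have lx: "linked (fst p) (snd p) x (key p x)" and ly: "linked (fst p) (snd p) y (key p y)"
        and ky: "key p y \<in> {1..Suc m}"
        by (rule key(2)[OF x], rule key(2)[OF y], rule key(1)[OF y])
      have ex: "0 \<le> excess (fst p) (snd p) k" if "k \<le> m" for k using p that by (auto simp: ballot_def)
      have "key p y - 1 \<le> m" "x - 1 \<le> m" using x ky by auto
      then have "linked (fst p) (snd p) (key p x) (key p y)"
        using linked_noncrossing[OF linked_sym[OF lx] linked_sym[OF ly] lt \<open>x < y\<close>] ex by blast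
      then have "linked (fst p) (snd p) x y"
        using lx ly by (metis linked_sym linked_trans)
      then have "key p x = key p y" using key_eq[OF x y] by blast
      then show False using lt(1) by simp
    qed
  qed blast
  then have "\<forall>p\<in>ballot m 0. \<exists>r. r \<in> Sort (Suc m) \<and>
      (\<forall>v\<in>{1..Suc m}. key p v = Min {w \<in> {1..Suc m}. inv r v \<le> inv r w})"
    by blast
  from bchoice[OF this] obtain f where
    f: "\<forall>p\<in>ballot m 0. f p \<in> Sort (Suc m) \<and>
      (\<forall>v\<in>{1..Suc m}. key p v = Min {w \<in> {1..Suc m}. inv (f p) v \<le> inv (f p) w})"
    by (rule exE)
  have "inj_on f (ballot m 0)"
  proof (rule inj_onI)
    fix p p' assume p: "p \<in> ballot m 0" and p': "p' \<in> ballot m 0" and "f p = f p'"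
    then have same: "key p v = key p' v" if "v \<in> {1..Suc m}" for v using f p p' that by simp
    have lk: "linked (fst p) (snd p) v w \<longleftrightarrow> linked (fst p') (snd p') v w"
      if "v \<in> {1..Suc m}" "w \<in> {1..Suc m}" for v w
    proof -
      have "key p v = key p w \<longleftrightarrow> key p' v = key p' w" using same that by simp
      then show ?thesis using key_eq[OF that] by blast
    qed
    obtain I J I' J' where IJ: "p = (I, J)" "p' = (I', J')" by (metis surj_pair)
    have sub: "I \<subseteq> {1..m}" "J \<subseteq> {1..m}" "I' \<subseteq> {1..m}" "J' \<subseteq> {1..m}"
      using p p' by (auto simp: IJ ballot_def)
    have "i \<in> J \<longleftrightarrow> i \<in> J'" "i \<in> I \<longleftrightarrow> i \<in> I'" if i: "i \<in> {1..m}" for i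
    proof -
      have i': "i \<in> {1..Suc m}" "Suc i \<in> {1..Suc m}" using i by auto
      have "(i = Suc m \<or> i \<in> J) \<longleftrightarrow> (i = Suc m \<or> i \<in> J')"
        unfolding linked_max[OF p[unfolded IJ] i'(1), symmetric] linked_max[OF p'[unfolded IJ] i'(1), symmetric]
        using lk[OF i'(1)] by (simp add: IJ)
      then show "i \<in> J \<longleftrightarrow> i \<in> J'" using i by simp
      have "(Suc i = 1 \<or> Suc i - 1 \<in> I) \<longleftrightarrow> (Suc i = 1 \<or> Suc i - 1 \<in> I')"
        unfolding linked_min[OF p[unfolded IJ] i'(2), symmetric] linked_min[OF p'[unfolded IJ] i'(2), symmetric]
        using lk[OF i'(2)] by (simp add: IJ)
      then show "i \<in> I \<longleftrightarrow> i \<in> I'" using i by simp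
    qed
    then have "I = I'" "J = J'" using sub by blast+
    then show "p = p'" by (simp add: IJ)
  qed
  moreover have "f ` ballot m 0 \<subseteq> Sort (Suc m)" using f by blast
  moreover have "finite (Sort (Suc m))"
    by (rule finite_subset[of _ "{s. s permutes {1..Suc m}}"]) (auto simp: Sort_def finite_permutations)
  ultimately show ?thesis by (metis card_image card_mono)
qed

section \<open>The q-Catalan formula\<close>

lemma bij_betw_extremes: "bij_betw (extremes m) (NC (Suc m)) (ballot m 0)"
proof (rule bij_betwI')
  show "(extremes m s = extremes m t) = (s = t)" if "s \<in> NC (Suc m)" "t \<in> NC (Suc m)" for s t
    using nested_extremes_inj NC_nested that by blast
  show "extremes m s \<in> ballot m 0" if "s \<in> NC (Suc m)" for s
    using that extremes_in_ballot by (simp add: NC_def)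
  show "\<exists>s\<in>NC (Suc m). p = extremes m s" if "p \<in> ballot m 0" for p
    using extremes_surj[OF that] by blast
qed

text \<open>An injection into a finite set that is not larger than its domain, by \<open>card_ballot_le_Sort\<close>.\<close>

lemma bij_betw_descents: "bij_betw (descents m) (Sort (Suc m)) (ballot m 0)"
proof -
  have inj: "inj_on (descents m) (Sort (Suc m))" using descents_inj by (blast intro: inj_onI)
  have sub: "descents m ` Sort (Suc m) \<subseteq> ballot m 0" using descents_in_ballot by blast
  have "card (ballot m 0) \<le> card (descents m ` Sort (Suc m))"
    using card_ballot_le_Sort card_image[OF inj] by simp
  then have "descents m ` Sort (Suc m) = ballot m 0"
    using card_seteq[OF finite_ballot sub] by blast
  then show ?thesis using inj by (simp add: bij_betw_def)
qed

theorem theorem1p1: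
  fixes n :: nat
  assumes "n \<ge> 1"
  shows "(\<Sum>\<sigma>\<in>NC n. qvar ^ (maj n \<sigma> + imaj n \<sigma>)) = (\<Sum>\<sigma>\<in>Sort n. qvar ^ (maj n \<sigma> + imaj n \<sigma>))
    \<and> (\<Sum>\<sigma>\<in>Sort n. qvar ^ (maj n \<sigma> + imaj n \<sigma>)) = 1 / qint qvar (n + 1) * qbinomial qvar (2 * n) n"
proof -
  obtain m where m: "n = Suc m" using assms by (cases n) auto
  note q = qgeneric_qvar
  have "(\<Sum>\<sigma>\<in>NC n. qvar ^ (maj n \<sigma> + imaj n \<sigma>)) = (\<Sum>\<sigma>\<in>NC (Suc m). qvar ^ close_wt m (extremes m \<sigma>))"
    unfolding m using nested_maj_imaj NC_nested by (intro sum.cong) auto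
  also have "\<dots> = (\<Sum>p\<in>ballot m 0. qvar ^ close_wt m p)"
    by (rule sum.reindex_bij_betw[OF bij_betw_extremes])
  also have "\<dots> = linear_gf qvar m 0" using sum_close_open_wt(1)[OF q, of 0 m] close_gf_eq_linear_gf[OF q] by simp
  finally have N: "(\<Sum>\<sigma>\<in>NC n. qvar ^ (maj n \<sigma> + imaj n \<sigma>)) = linear_gf qvar m 0" .
  have "(\<Sum>\<sigma>\<in>Sort n. qvar ^ (maj n \<sigma> + imaj n \<sigma>)) = (\<Sum>\<sigma>\<in>Sort (Suc m). qvar ^ linear_wt (descents m \<sigma>))"
    unfolding m descents_linear_wt ..
  also have "\<dots> = (\<Sum>p\<in>ballot m 0. qvar ^ linear_wt p)"
    by (rule sum.reindex_bij_betw[OF bij_betw_descents])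
  also have "\<dots> = linear_gf qvar m 0" using sum_linear_wt[OF q, of 0 m] by simp
  finally have S: "(\<Sum>\<sigma>\<in>Sort n. qvar ^ (maj n \<sigma> + imaj n \<sigma>)) = linear_gf qvar m 0" .
  show ?thesis unfolding N S linear_gf_q_catalan[OF q] by (simp add: m)
qed

end
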